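(* For every $\Pi\in\{\textsc{Coloring},\textsc{Clique Cover}\}$, $\mathrm{Rel}(\Pi,\mathrm{dist}_\Delta,n^{\frac12})$ and $\mathrm{Rel}(\Pi,\mathrm{dist}_E,n^{\frac43})$ are in FP.
   Context: For a problem $\Pi$, a metric $\mathrm{dist}$ on its inputs, and a non-decreasing function $d:\mathbb N\to\mathbb R_+\cup\{\infty\}$, the function problem $\mathrm{Rel}(\Pi,\mathrm{dist},d)$ is: given an input $I$ of $\Pi$, output a pair $(J,\Pi(J))$ where $J$ is an input of $\Pi$ with $\mathrm{dist}(I,J)\le d(|I|)$ and $\Pi(J)$ is a correct answer to $\Pi$ on $J$ (a correct solution on $J$, or $\mathrm{nil}$ if none exists). For graph problems $|I|$ is the number of vertices $n$ of the input graph. For graphs $G,H$: $\mathrm{dist}_E(G,H)=|E(G)\triangle E(H)|$ if $V(G)=V(H)$ and $\infty$ otherwise; $\mathrm{dist}_\Delta(G,H)$ is the maximum degree of the graph on $V(G)$ with edge set $E(G)\triangle E(H)$ if $V(G)=V(H)$, and $\infty$ otherwise. For inputs $(G,k),(H,\ell)$, $\mathrm{dist}((G,k),(H,\ell))=\mathrm{dist}(G,H)$ if $k=\ell$ and $\infty$ otherwise. \textsc{Coloring}: given a graph $G$ and an integer $k\in[0,|V(G)|]$, output a partition of $V(G)$ into $k$ independent sets of $G$, or $\mathrm{nil}$ if none exists. \textsc{Clique Cover}: given $G$ and $k$, output a partition of $V(G)$ into $k$ cliques of $G$, or $\mathrm{nil}$ if none exists. FP is the class of function problems solvable in polynomial time.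 *)

theory Defs
  imports
    Complex_Main
    "HOL-Library.Disjoint_Sets"
    "HOL-Library.Extended_Nonnegative_Real"
    "HOL-Computational_Algebra.Polynomial"
begin

section \<open>Search problems and the relaxation \<open>Rel\<close>\<close>

record ('i, 's) search_problem =
  inputs :: "'i set"
  input_size :: "'i \<Rightarrow> nat"
  is_solution :: "'i \<Rightarrow> 's \<Rightarrow> bool"

text \<open>\<^const>\<open>None\<close> is the answer nil.\<close>

definition correct_answer :: "('i, 's) search_problem \<Rightarrow> 'i \<Rightarrow> 's option \<Rightarrow> bool" where
  "correct_answer Pr I a \<longleftrightarrow>
     (case a of
        Some s \<Rightarrow> is_solution Pr I s
      | None \<Rightarrow> \<not> (\<exists>s. is_solution Pr I s))"

record ('i, 'o) function_problem =
  instances :: "'i set"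
  is_output :: "'i \<Rightarrow> 'o \<Rightarrow> bool"

definition Rel ::
  "('i, 's) search_problem \<Rightarrow> ('i \<Rightarrow> 'i \<Rightarrow> ennreal) \<Rightarrow> (nat \<Rightarrow> ennreal)
    \<Rightarrow> ('i, 'i \<times> 's option) function_problem" where
  "Rel Pr \<delta> d =
     \<lparr> instances = inputs Pr,
       is_output = (\<lambda>I (J, a).
         J \<in> inputs Pr \<and> \<delta> I J \<le> d (input_size Pr I) \<and> correct_answer Pr J a) \<rparr>"


section \<open>Graphs\<close>

record 'a graph =
  verts :: "'a set"
  edges :: "'a set set"

definition simple_graph :: "'a graph \<Rightarrow> bool" where
  "simple_graph G \<longleftrightarrow>
     finite (verts G) \<and> (\<forall>e\<in>edges G. \<exists>u\<in>verts G. \<exists>v\<in>verts G. u \<noteq> v \<and> e = {u, v})"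

definition degree_in :: "'a graph \<Rightarrow> 'a \<Rightarrow> nat" where
  "degree_in G v = card {e \<in> edges G. v \<in> e}"

text \<open>The inserted \<open>0\<close> only matters for the graph without vertices.\<close>

definition max_degree :: "'a graph \<Rightarrow> nat" where
  "max_degree G = Max (insert 0 (degree_in G ` verts G))"

definition edge_diff :: "'a graph \<Rightarrow> 'a graph \<Rightarrow> 'a set set" where
  "edge_diff G H = (edges G - edges H) \<union> (edges H - edges G)"

definition dist_E :: "'a graph \<Rightarrow> 'a graph \<Rightarrow> ennreal" where
  "dist_E G H =
     (if verts G = verts H then of_nat (card (edge_diff G H)) else \<infinity>)"

definition dist_Delta :: "'a graph \<Rightarrow> 'a graph \<Rightarrow> ennreal" where
  "dist_Delta G H =
     (if verts G = verts H
      then of_nat (max_degree \<lparr> verts = verts G, edges = edge_diff G H \<rparr>) else \<infinity>)"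

fun dist_param :: "('a graph \<Rightarrow> 'a graph \<Rightarrow> ennreal)
    \<Rightarrow> 'a graph \<times> nat \<Rightarrow> 'a graph \<times> nat \<Rightarrow> ennreal" where
  "dist_param \<delta> (G, k) (H, l) = (if k = l then \<delta> G H else \<infinity>)"

definition independent_set :: "'a graph \<Rightarrow> 'a set \<Rightarrow> bool" where
  "independent_set G A \<longleftrightarrow> A \<subseteq> verts G \<and> (\<forall>u\<in>A. \<forall>v\<in>A. {u, v} \<notin> edges G)"

definition clique :: "'a graph \<Rightarrow> 'a set \<Rightarrow> bool" where
  "clique G A \<longleftrightarrow> A \<subseteq> verts G \<and> (\<forall>u\<in>A. \<forall>v\<in>A. u \<noteq> v \<longrightarrow> {u, v} \<in> edges G)"


section \<open>Coloring and Clique Cover\<close>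

text \<open>Graphs that are given to a machine have the vertex set \<open>{0, \<dots>, n - 1}\<close>.\<close>

definition graph_inputs :: "(nat graph \<times> nat) set" where
  "graph_inputs =
     {(G, k). simple_graph G \<and> verts G = {..<card (verts G)} \<and> k \<le> card (verts G)}"

definition Coloring :: "(nat graph \<times> nat, nat set set) search_problem" where
  "Coloring =
     \<lparr> inputs = graph_inputs,
       input_size = (\<lambda>(G, k). card (verts G)),
       is_solution = (\<lambda>(G, k) P.
         partition_on (verts G) P \<and> card P = k \<and> (\<forall>A\<in>P. independent_set G A)) \<rparr>"

definition Clique_Cover :: "(nat graph \<times> nat, nat set set) search_problem" where
  "Clique_Cover =
     \<lparr> inputs = graph_inputs,
       input_size = (\<lambda>(G, k). card (verts G)),
       is_solution = (\<lambda>(G, k) P.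
         partition_on (verts G) P \<and> card P = k \<and> (\<forall>A\<in>P. clique G A)) \<rparr>"


section \<open>Binary encodings\<close>

text \<open>
  \<open>enc_input\<close> writes \<open>n\<close> in unary, then the \<open>n * n\<close> bits of the adjacency matrix row by
  row, then \<open>k\<close> in unary.  As \<open>k \<le> n\<close>, unary and binary encodings of \<open>k\<close> lead to word lengths
  that are polynomially related.
\<close>

definition enc_nat :: "nat \<Rightarrow> bool list" where
  "enc_nat k = replicate k True @ [False]"

definition enc_graph :: "nat graph \<Rightarrow> bool list" where
  "enc_graph G =
     (let n = card (verts G)
      in enc_nat n @ concat (map (\<lambda>i. map (\<lambda>j. {i, j} \<in> edges G) [0..<n]) [0..<n]))"

fun enc_input :: "nat graph \<times> nat \<Rightarrow> bool list" where
  "enc_input (G, k) = enc_graph G @ enc_nat k"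

text \<open>
  A set of vertices is written as its characteristic vector.  A partition is written as the
  sequence of its parts, in any order, so an output has several encodings.
\<close>

definition enc_vertex_set :: "nat \<Rightarrow> nat set \<Rightarrow> bool list" where
  "enc_vertex_set n A = map (\<lambda>i. i \<in> A) [0..<n]"

fun enc_output :: "(nat graph \<times> nat) \<times> nat set set option \<Rightarrow> bool list set" where
  "enc_output ((H, l), None) = {enc_input (H, l) @ [False]}"
| "enc_output ((H, l), Some P) =
     {enc_input (H, l) @ True # concat (map (enc_vertex_set (card (verts H))) As) |As.
       distinct As \<and> set As = P}"


section \<open>Deterministic multi-tape Turing machines and FP\<close>

datatype move = Left | Stay | Right

text \<open>
  States and tape symbols are natural numbers below the respective bound, and symbol \<open>0\<close> is the
  blank.  The start state is \<open>0\<close>, and the machine halts on reaching state \<open>num_states M\<close>.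
  On the symbols under the heads, \<open>delta M q\<close> gives the next state and, for each tape, the symbol
  to write and the head movement.
\<close>

record turing_machine =
  num_tapes :: nat
  num_symbols :: nat
  num_states :: nat
  delta :: "nat \<Rightarrow> nat list \<Rightarrow> nat \<times> (nat \<times> move) list"

definition wf_machine :: "turing_machine \<Rightarrow> bool" where
  "wf_machine M \<longleftrightarrow>
     num_tapes M \<ge> 1 \<and> num_symbols M \<ge> 3 \<and>
     (\<forall>q < num_states M. \<forall>xs. length xs = num_tapes M \<and> set xs \<subseteq> {..<num_symbols M} \<longrightarrow>
        (case delta M q xs of (q', acts) \<Rightarrow>
           q' \<le> num_states M \<and> length acts = num_tapes M \<and>
           (\<forall>(a, d)\<in>set acts. a < num_symbols M)))"

text \<open>A tape is its content, which is infinite in both directions, and its head position.\<close>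

type_synonym tape = "(int \<Rightarrow> nat) \<times> int"

type_synonym config = "nat \<times> tape list"

fun read_tape :: "tape \<Rightarrow> nat" where
  "read_tape (f, p) = f p"

fun act_tape :: "nat \<times> move \<Rightarrow> tape \<Rightarrow> tape" where
  "act_tape (a, d) (f, p) =
     (f(p := a), case d of Left \<Rightarrow> p - 1 | Stay \<Rightarrow> p | Right \<Rightarrow> p + 1)"

fun step :: "turing_machine \<Rightarrow> config \<Rightarrow> config" where
  "step M (q, ts) =
     (if q < num_states M
      then case delta M q (map read_tape ts) of (q', acts) \<Rightarrow> (q', map2 act_tape acts ts)
      else (q, ts))"

text \<open>A word occupies the cells \<open>0, 1, \<dots>\<close>, with symbol \<open>1\<close> for \<open>False\<close> and \<open>2\<close> for \<open>True\<close>.\<close>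

definition word_on_tape :: "bool list \<Rightarrow> int \<Rightarrow> nat" where
  "word_on_tape w i =
     (if 0 \<le> i \<and> i < int (length w) then (if w ! nat i then 2 else 1) else 0)"

text \<open>The first tape holds the input, the last tape receives the output.\<close>

definition initial_config :: "turing_machine \<Rightarrow> bool list \<Rightarrow> config" where
  "initial_config M w =
     (0, (word_on_tape w, 0) # replicate (num_tapes M - 1) (word_on_tape [], 0))"

definition outputs_within :: "turing_machine \<Rightarrow> bool list \<Rightarrow> bool list \<Rightarrow> nat \<Rightarrow> bool" where
  "outputs_within M w y t \<longleftrightarrow>
     (\<exists>s \<le> t. case (step M ^^ s) (initial_config M w) of (q, ts) \<Rightarrow>
        q = num_states M \<and> fst (last ts) = word_on_tape y)"

definition FP :: "('i \<Rightarrow> bool list) \<Rightarrow> ('o \<Rightarrow> bool list set) \<Rightarrow> ('i, 'o) function_problem set" where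
  "FP enc_in enc_out =
     {F. \<exists>M (p :: nat poly). wf_machine M \<and>
        (\<forall>I\<in>instances F. \<exists>out y.
           is_output F I out \<and> y \<in> enc_out out \<and>
           outputs_within M (enc_in I) y (poly p (length (enc_in I))))}"

end

theory Submission
  imports Defs
begin

text \<open>
  Let \<open>q = n div k\<close>.  If \<open>q\<close> is small compared to \<open>k\<close>, then the \<open>k\<close> residue classes modulo \<open>k\<close>
  are made independent (or cliques): every vertex has at most \<open>q\<close> other vertices in its class,
  so at most \<open>n * q / 2\<close> edges change.  Otherwise the \<open>k + 1\<close> vertices \<open>0, \<dots>, k\<close> are made a
  clique (or independent), so the answer is nil; every degree changes by at most \<open>k\<close>, and at most
  \<open>k * (k + 1) / 2\<close> edges change.  The threshold is \<open>q \<le> k\<close> for degrees and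
  \<open>q * (q + 1) / 2 \<le> k\<close> for edges; together with \<open>q * k \<le> n\<close> this yields the bounds
  \<open>n powr (1 / 2)\<close> and \<open>n powr (4 / 3)\<close> in both cases.
\<close>

section \<open>Reachability between configurations\<close>

text \<open>The thresholds balance the two modifications: the residue classes cost about n*q/2
  edges, the k + 1 vertices about k^2/2. With q near n/k both are of order n^(4/3) at k = n^(2/3), q
  = n^(1/3), that is, when q^2 is of order k; for degrees, q and k balance at n^(1/2). The form
  q*(q+1)/2 is chosen because it is 1 + ... + q: a unary counter that grows by one cell per multiple
  pays it in instalments, so nothing is multiplied or divided on the tapes, and at most k <= n
  budget cells are ever passed.

  The other obstacle is to keep an explicit machine small enough to verify. Whether i and j are
  congruent modulo k depends only on j - i, so marks at the multiples of k on both sides of 0,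
  written once, replace all later arithmetic. Coloring and Clique Cover differ only in the bit
  written at the affected entries, hence the flag \<open>col\<close>. The required bounds leave no
  constant factor to spare, so edges are counted as half of a degree sum.\<close>

definition reach :: "turing_machine \<Rightarrow> nat \<Rightarrow> config \<Rightarrow> config \<Rightarrow> bool" where
  "reach M t c c' \<longleftrightarrow> (\<exists>s\<le>t. (step M ^^ s) c = c')"

lemma reach_refl: "reach M t c c"
  unfolding reach_def by (rule exI[of _ 0]) simp

lemma reach_step: "step M c = c' \<Longrightarrow> reach M (Suc 0) c c'"
  unfolding reach_def by (rule exI[of _ 1]) simp

lemma reach_mono: "reach M s c c' \<Longrightarrow> s \<le> t \<Longrightarrow> reach M t c c'"
  unfolding reach_def using order_trans by blast

text \<open>Since \<open>reach\<close> only bounds the number of steps from above, the times of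
  consecutive phases add up and can be rounded generously by \<open>reach_mono\<close>.\<close>

lemma reach_trans [trans]:
  assumes "reach M s a b" "reach M t b c"
  shows "reach M (s + t) a c"
proof -
  obtain s' t' where *: "s' \<le> s" "(step M ^^ s') a = b" "t' \<le> t" "(step M ^^ t') b = c"
    using assms unfolding reach_def by blast
  then have "(step M ^^ (t' + s')) a = c"
    by (simp add: funpow_add)
  then show ?thesis
    unfolding reach_def using * by (intro exI[of _ "t' + s'"]) auto
qed

lemma reach_loop:
  assumes "\<And>i. i < m \<Longrightarrow> reach M d (c i) (c (Suc i))"
  shows "reach M (m * d) (c 0) (c m)"
  using assms
proof (induction m)
  case 0
  show ?case by (simp add: reach_refl)
next
  case (Suc m)
  have "reach M (m * d) (c 0) (c m)"
    using Suc by simp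
  also have "reach M d (c m) (c (Suc m))"
    using Suc.prems by simp
  finally show ?case by (simp add: add.commute)
qed

text \<open>The shape of every scan within one state: \<open>m\<close> rounds that stay in the state
  and one step that leaves it.\<close>

lemma reach_while:
  assumes "\<And>i. i < m \<Longrightarrow> step M (c i) = c (Suc i)" and "step M (c m) = c'"
  shows "reach M (Suc m) (c 0) c'"
proof -
  have "reach M (m * Suc 0) (c 0) (c m)"
    by (rule reach_loop) (simp add: assms(1) reach_step)
  also have "reach M (Suc 0) (c m) c'"
    by (rule reach_step) (rule assms(2))
  finally show ?thesis by simp
qed


section \<open>The machine\<close>

abbreviation keep :: "nat \<Rightarrow> nat \<times> move" where "keep x \<equiv> (x, Stay)"
abbreviation lft :: "nat \<Rightarrow> nat \<times> move" where "lft x \<equiv> (x, Left)"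
abbreviation rgt :: "nat \<Rightarrow> nat \<times> move" where "rgt x \<equiv> (x, Right)"

text \<open>
  Tapes: the input; four copies of a ruler of length \<open>n\<close> that serve as row counter, column counter,
  counter modulo \<open>k\<close> and budget counter; two tapes whose cells \<open>x > 0\<close> and \<open>x < 0\<close>, respectively,
  mark the multiples of \<open>k\<close>; a tape that first holds a unary counter and then the mode; the output.
  The heads of the two mark tapes stand at \<open>j - i\<close> when entry \<open>(i, j)\<close> is written, and
  symbol \<open>2\<close> in cell \<open>0\<close> of the first of them identifies the diagonal.

  Modes: \<open>1\<close> writes the matrix with \<open>0, \<dots>, k\<close> made a clique (or independent), \<open>2\<close> the matrix
  with the residue classes made independent (or cliques), \<open>3\<close> the characteristic vectors of the
  residue classes.

  States: 0--5 prepare the rulers; 6--10 mark the multiples of \<open>k\<close> up to \<open>n\<close>, and the \<open>q\<close>-th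
  multiple costs \<open>q\<close> units of the budget \<open>k\<close> if \<open>ed\<close> holds, otherwise one unit; the mode is \<open>1\<close> iff the
  budget is exceeded.  11--13 rewind; 14--15 write the rows; 16 copies \<open>k\<close>; 17 rewinds for mode \<open>3\<close>.
\<close>

definition cell_symbol :: "bool \<Rightarrow> nat \<Rightarrow> nat \<Rightarrow> nat \<Rightarrow> nat \<Rightarrow> nat \<Rightarrow> nat \<Rightarrow> nat" where
  "cell_symbol col m i a b r s =
     (if m = 1 then
        if 2 \<le> a \<and> 2 \<le> b \<and> r \<noteq> 2 then if col then 2 else 1 else i
      else if m = 2 then
        if r = 1 \<or> s = 1 then if col then 1 else 2 else i
      else if r \<noteq> 0 \<or> s \<noteq> 0 then 2 else 1)"

definition transition :: "bool \<Rightarrow> bool \<Rightarrow> nat \<Rightarrow> nat \<Rightarrow> nat \<Rightarrow> nat \<Rightarrow> nat \<Rightarrow> nat \<Rightarrow> nat \<Rightarrow> nat \<Rightarrow> nat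
    \<Rightarrow> nat \<Rightarrow> nat \<times> (nat \<times> move) list" where
  "transition col ed q i a b c d r s m u =
    (if q = 0 then
       if i = 2
       then (0, [rgt i, rgt 1, rgt 1, rgt 1, rgt 1, keep r, keep s, keep m, rgt 2])
       else (1, [rgt i, lft a, lft b, lft c, lft d, keep r, keep s, keep m, rgt 1])
     else if q = 1 then
       if a \<noteq> 0
       then (1, [keep i, lft a, lft b, lft c, lft d, keep r, keep s, keep m, keep u])
       else (2, [keep i, rgt a, rgt b, rgt c, rgt d, keep r, keep s, keep m, keep u])
     else if q = 2 then
       if i \<noteq> 0
       then (2, [rgt i, keep a, keep b, keep c, keep d, keep r, keep s, keep m, keep u])
       else (3, [lft i, keep a, keep b, keep c, keep d, keep r, keep s, keep m, keep u])
     else if q = 3 then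
       (4, [lft i, keep a, keep b, keep c, keep d, keep r, keep s, keep m, keep u])
     else if q = 4 then
       if i = 2
       then (4, [lft i, rgt 2, rgt 2, rgt 2, rgt 2, keep r, keep s, keep m, keep u])
       else let v = if a = 0 then 0 else 3
            in (5, [keep i, lft v, lft v, lft v, lft v, keep r, keep s, keep m, keep u])
     else if q = 5 then
       if a \<noteq> 0
       then (5, [keep i, lft a, lft b, lft c, lft d, keep r, keep s, keep m, keep u])
       else (6, [keep i, rgt a, rgt b, rgt c, rgt d, keep 2, keep s, keep m, keep u])
     else if q = 6 then
       if a \<noteq> 0
       then (7, [keep i, rgt a, keep b, rgt c, keep d, rgt r, lft s, keep m, keep u])
       else (11, [keep i, lft a, keep b, keep c, keep d, lft r, rgt s, keep 2, keep u])
     else if q = 7 then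
       if c = 2
       then (6, [keep i, keep a, keep b, keep c, keep d, keep r, keep s, keep m, keep u])
       else (8, [keep i, keep a, keep b, keep c, keep d, keep 1, keep 1, keep m, keep u])
     else if q = 8 then
       if d \<noteq> 2
       then (11, [keep i, lft a, keep b, keep c, keep d, lft r, rgt s, keep 1, keep u])
       else if m \<noteq> 0
       then (8, [keep i, keep a, keep b, keep c, rgt d, keep r, keep s, rgt m, keep u])
       else let v = if ed then 1 else 0
            in (9, [keep i, keep a, keep b, keep c, rgt d, keep r, keep s, lft v, keep u])
     else if q = 9 then
       if m \<noteq> 0
       then (9, [keep i, keep a, keep b, keep c, keep d, keep r, keep s, lft m, keep u])
       else (10, [keep i, keep a, keep b, lft c, keep d, keep r, keep s, rgt m, keep u])
     else if q = 10 then
       if c \<noteq> 0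
       then (10, [keep i, keep a, keep b, lft c, keep d, keep r, keep s, keep m, keep u])
       else (6, [keep i, keep a, keep b, rgt c, keep d, keep r, keep s, keep m, keep u])
     else if q = 11 then
       if a \<noteq> 0
       then (11, [keep i, lft a, keep b, keep c, keep d, lft r, rgt s, keep m, keep u])
       else (12, [keep i, rgt a, keep b, keep c, keep d, rgt r, lft s, keep m, keep u])
     else if q = 12 then
       if i \<noteq> 0
       then (12, [lft i, keep a, keep b, keep c, keep d, keep r, keep s, keep m, keep u])
       else (13, [rgt i, keep a, keep b, keep c, keep d, keep r, keep s, keep m, keep u])
     else if q = 13 then
       if i = 2
       then (13, [rgt i, keep a, keep b, keep c, keep d, keep r, keep s, keep m, keep u])
       else (14, [rgt i, keep a, keep b, keep c, keep d, keep r, keep s, keep m, keep u])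
     else if q = 14 then
       if a = 0 \<or> m = 3 \<and> a \<noteq> 2
       then (if m = 3 then 18 else 16,
             [keep i, keep a, keep b, keep c, keep d, keep r, keep s, keep m, keep u])
       else if b \<noteq> 0
       then (14, [rgt i, keep a, rgt b, keep c, keep d, rgt r, rgt s, keep m,
                  rgt (cell_symbol col m i a b r s)])
       else (15, [keep i, keep a, lft b, keep c, keep d, lft r, lft s, keep m, keep u])
     else if q = 15 then
       if b \<noteq> 0
       then (15, [keep i, keep a, lft b, keep c, keep d, lft r, lft s, keep m, keep u])
       else (14, [keep i, rgt a, rgt b, keep c, keep d, keep r, keep s, keep m, keep u])
     else if q = 16 then
       if i \<noteq> 0
       then (16, [rgt i, keep a, keep b, keep c, keep d, keep r, keep s, keep m, rgt i])
       else if m = 1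
       then (18, [keep i, keep a, keep b, keep c, keep d, keep r, keep s, keep m, rgt 1])
       else (17, [keep i, lft a, keep b, keep c, keep d, rgt r, rgt s, keep 3, rgt 2])
     else
       if a \<noteq> 0
       then (17, [keep i, lft a, keep b, keep c, keep d, rgt r, rgt s, keep m, keep u])
       else (14, [keep i, rgt a, keep b, keep c, keep d, lft r, lft s, keep m, keep u]))"

definition machine :: "bool \<Rightarrow> bool \<Rightarrow> turing_machine" where
  "machine col ed =
     \<lparr> num_tapes = 9, num_symbols = 4, num_states = 18,
       delta = (\<lambda>q xs. case xs of [i, a, b, c, d, r, s, m, u] \<Rightarrow>
         transition col ed q i a b c d r s m u) \<rparr>"

section \<open>Well-formedness and symbolic execution of the machine\<close>

lemma length_9_cases:
  assumes "length xs = 9"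
  obtains i a b c d r s m u where "xs = [i, a, b, c, d, r, s, m, u]"
  using assms by (auto simp: numeral_eq_Suc length_Suc_conv)

lemma transition_wf:
  fixes i :: nat
  assumes "i < 4" "a < 4" "b < 4" "c < 4" "d < 4" "r < 4" "s < 4" "m < 4" "u < 4"
    and "transition col ed q i a b c d r s m u = (q', acts)"
  shows "q' \<le> 18 \<and> length acts = 9 \<and> (\<forall>(x, y)\<in>set acts. x < 4)"
proof -
  have *: "cell_symbol col m i a b r s < 4"
    using assms by (simp add: cell_symbol_def)
  show ?thesis
    using assms * unfolding transition_def Let_def
    by (auto split: if_splits)
qed

lemma wf_machine: "wf_machine (machine col ed)"
  unfolding wf_machine_def
proof (intro conjI allI impI)
  fix q xs
  assume "length xs = num_tapes (machine col ed) \<and> set xs \<subseteq> {..<num_symbols (machine col ed)}"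
  then have len: "length xs = 9" and sub: "set xs \<subseteq> {..<4}"
    by (simp_all add: machine_def)
  obtain i a b c d r s m u where xs: "xs = [i, a, b, c, d, r, s, m, u]"
    using len by (rule length_9_cases)
  obtain q' acts where "transition col ed q i a b c d r s m u = (q', acts)"
    by (metis surj_pair)
  moreover have "q' \<le> 18 \<and> length acts = 9 \<and> (\<forall>(x, y)\<in>set acts. x < 4)"
    using transition_wf[OF _ _ _ _ _ _ _ _ _ calculation] sub xs by simp
  ultimately show "case delta (machine col ed) q xs of (q', acts) \<Rightarrow>
      q' \<le> num_states (machine col ed) \<and> length acts = num_tapes (machine col ed) \<and>
      (\<forall>(a, d)\<in>set acts. a < num_symbols (machine col ed))"
    by (simp add: machine_def xs)
qed (simp_all add: machine_def)

text \<open>With the nine tapes spelled out, a step from a concrete state is evaluated by rewriting;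
  \<open>fun_upd_idem\<close> then removes the writes that put back the symbol just read.\<close>

lemma step_machine:
  assumes "q < 18"
  shows "step (machine col ed) (q, [(fi, xi), (fa, xa), (fb, xb), (fc, xc), (fd, xd), (fr, xr),
           (fs, xs), (fm, xm), (fu, xu)]) =
         (case transition col ed q (fi xi) (fa xa) (fb xb) (fc xc) (fd xd) (fr xr) (fs xs)
             (fm xm) (fu xu) of
           (q', acts) \<Rightarrow> (q', map2 act_tape acts [(fi, xi), (fa, xa), (fb, xb), (fc, xc),
             (fd, xd), (fr, xr), (fs, xs), (fm, xm), (fu, xu)]))"
  using assms by (simp add: machine_def)

declare step.simps [simp del]

lemma initial_config_machine:
  "initial_config (machine col ed) w =
     (0, [(word_on_tape w, 0), (word_on_tape [], 0), (word_on_tape [], 0), (word_on_tape [], 0),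
          (word_on_tape [], 0), (word_on_tape [], 0), (word_on_tape [], 0), (word_on_tape [], 0),
          (word_on_tape [], 0)])"
  by (simp add: initial_config_def machine_def eval_nat_numeral)


section \<open>Tape contents\<close>

lemma word_on_tape_of_nat:
  "word_on_tape w (int i) = (if i < length w then if w ! i then 2 else 1 else 0)"
  by (simp add: word_on_tape_def)

lemma word_on_tape_negative: "x < 0 \<Longrightarrow> word_on_tape w x = 0"
  by (simp add: word_on_tape_def)

lemma word_on_tape_snoc:
  "(word_on_tape w)(int (length w) := if b then 2 else 1) = word_on_tape (w @ [b])"
  by (rule ext) (auto simp: word_on_tape_def nth_append nat_less_iff)

text \<open>
  Symbol \<open>2\<close> stands in the cells below \<open>k\<close> and symbol \<open>3\<close> in cell \<open>k\<close>, so \<open>i < k\<close>, \<open>i \<le> k\<close>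
  and \<open>i < n\<close> can all be read off the cell \<open>i\<close>; there is no symbol \<open>3\<close> if \<open>k = n\<close>.
\<close>

definition ruler :: "nat \<Rightarrow> nat \<Rightarrow> bool \<Rightarrow> int \<Rightarrow> nat" where
  "ruler n k h x =
     (if x < 0 \<or> int n \<le> x then 0 else if x < int k then 2 else if x = int k \<and> h then 3 else 1)"

lemma blank_eq_ruler: "word_on_tape [] = ruler 0 0 False"
  by (rule ext) (auto simp: word_on_tape_def ruler_def)

lemma ruler_extend: "(ruler m 0 False)(int m := Suc 0) = ruler (Suc m) 0 False"
  by (rule ext) (auto simp: ruler_def)

lemma ruler_mark: "j < n \<Longrightarrow> (ruler n j False)(int j := 2) = ruler n (Suc j) False"
  by (rule ext) (auto simp: ruler_def)

text \<open>If \<open>k = n\<close>, the cell \<open>k\<close> lies just beyond the ruler, and the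
  machine writes back the blank that it finds there.\<close>

lemma ruler_top:
  "k < n \<Longrightarrow> (ruler n k False)(int k := 3) = ruler n k True"
  "(ruler n n False)(int n := 0) = ruler n n True"
  by (rule ext, auto simp: ruler_def)+

text \<open>Here \<open>x\<close> counts the cells scanned so far. Separate tapes for the two signs
  allow both marks of a multiple to be written in the same step, by heads that move apart.\<close>

definition pos_multiples :: "nat \<Rightarrow> nat \<Rightarrow> int \<Rightarrow> nat" where
  "pos_multiples k x y =
     (if y = 0 then 2 else if 0 < y \<and> y \<le> int x \<and> int k dvd y then 1 else 0)"

definition neg_multiples :: "nat \<Rightarrow> nat \<Rightarrow> int \<Rightarrow> nat" where
  "neg_multiples k x y = (if y < 0 \<and> - int x \<le> y \<and> int k dvd y then 1 else 0)"

lemma blank_eq_neg_multiples: "word_on_tape [] = neg_multiples k 0"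
  by (rule ext) (simp add: word_on_tape_def neg_multiples_def)

lemma pos_multiples_0: "(word_on_tape [])(0 := 2) = pos_multiples k 0"
  by (rule ext) (simp add: word_on_tape_def pos_multiples_def)

lemma multiples_Suc:
  assumes "k dvd Suc x"
  shows "(pos_multiples k x)(int (Suc x) := Suc 0) = pos_multiples k (Suc x)"
    and "(neg_multiples k x)(- int (Suc x) := Suc 0) = neg_multiples k (Suc x)"
proof -
  have d: "int k dvd int (Suc x)"
    using assms of_nat_dvd_iff by blast
  then have d': "int k dvd - int (Suc x)"
    by (simp only: dvd_minus_iff)
  show "(pos_multiples k x)(int (Suc x) := Suc 0) = pos_multiples k (Suc x)"
  proof
    fix y
    show "((pos_multiples k x)(int (Suc x) := Suc 0)) y = pos_multiples k (Suc x) y"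
      using d by (cases "y = int (Suc x)") (auto simp: pos_multiples_def)
  qed
  show "(neg_multiples k x)(- int (Suc x) := Suc 0) = neg_multiples k (Suc x)"
  proof
    fix y
    show "((neg_multiples k x)(- int (Suc x) := Suc 0)) y = neg_multiples k (Suc x) y"
      using d' by (cases "y = - int (Suc x)") (auto simp: neg_multiples_def)
  qed
qed

lemma multiples_Suc_not:
  assumes "\<not> k dvd Suc x"
  shows "pos_multiples k (Suc x) = pos_multiples k x"
    and "neg_multiples k (Suc x) = neg_multiples k x"
proof -
  have d: "\<not> int k dvd int (Suc x)"
    using assms of_nat_dvd_iff by blast
  then have d': "\<not> int k dvd - int (Suc x)"
    by (simp only: dvd_minus_iff simp_thms)
  show "pos_multiples k (Suc x) = pos_multiples k x"
  proof
    fix y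
    show "pos_multiples k (Suc x) y = pos_multiples k x y"
      using d by (cases "y = int (Suc x)") (auto simp: pos_multiples_def)
  qed
  show "neg_multiples k (Suc x) = neg_multiples k x"
  proof
    fix y
    show "neg_multiples k (Suc x) y = neg_multiples k x y"
      using d' by (cases "y = - int (Suc x)") (auto simp: neg_multiples_def)
  qed
qed


text \<open>The threshold quantity in the form in which the budget head accumulates it, one price
  per multiple of \<open>k\<close>.\<close>

definition cost :: "bool \<Rightarrow> nat \<Rightarrow> nat" where
  "cost ed q = (\<Sum>i<q. if ed then Suc i else 1)"

lemma cost_0: "cost ed 0 = 0"
  by (simp add: cost_def)

lemma cost_Suc: "cost ed (Suc j) = Suc (cost ed j + (if ed then j else 0))"
  by (simp add: cost_def)


section \<open>Reading the input\<close>

text \<open>The matrix is just a bit list here; graphs enter when the locale is interpreted. The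
  assumption \<open>last_mat\<close> concerns the last diagonal entry, which is \<open>False\<close>
  because there are no loops.\<close>

locale machine_run =
  fixes col ed :: bool and n k :: nat and mat :: "bool list"
  assumes k_le: "k \<le> n" and length_mat: "length mat = n * n"
    and last_mat: "n > 0 \<Longrightarrow> \<not> mat ! (n * n - 1)"
begin

abbreviation "M \<equiv> machine col ed"

definition input_word :: "bool list" where
  "input_word = enc_nat n @ mat @ enc_nat k"

abbreviation "F \<equiv> word_on_tape input_word"

abbreviation "blank \<equiv> word_on_tape []"

lemma length_input_word: "length input_word = n + 1 + n * n + k + 1"
  by (simp add: input_word_def enc_nat_def length_mat)

lemma F_nonblank: "i < n + 1 + n * n + k + 1 \<Longrightarrow> F (int i) \<noteq> 0"
  by (simp add: word_on_tape_of_nat length_input_word)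

lemma F_end: "F (int (n + 1 + n * n + k + 1)) = 0"
  by (subst word_on_tape_of_nat) (simp add: length_input_word)

lemma F_size: "i < n \<Longrightarrow> F (int i) = 2" "F (int n) = 1"
  by (simp_all add: word_on_tape_of_nat length_input_word)
     (simp_all add: input_word_def enc_nat_def nth_append)

lemma F_mat: "i < n * n \<Longrightarrow> F (int (n + 1 + i)) = (if mat ! i then 2 else 1)"
  by (subst word_on_tape_of_nat)
     (simp add: length_input_word, simp add: input_word_def enc_nat_def nth_append length_mat)

text \<open>The parameter is read backwards from the end of the input, so that its place need not be
  found by counting n*n bits. The delimiter on its left is then the last diagonal entry or, for
  \<open>n = 0\<close>, the end of the unary \<open>n\<close>.\<close>

lemma F_before_param: "F (int (n + n * n)) = 1"
proof (cases "n = 0")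
  case True
  then show ?thesis using F_size(2) by simp
next
  case False
  then have "n + n * n = n + 1 + (n * n - 1)" by simp
  then show ?thesis
    using F_mat[of "n * n - 1"] last_mat False by simp
qed

lemma F_param: "i \<le> k \<Longrightarrow> F (int (n + 1 + n * n + i)) = (if i < k then 2 else 1)"
  by (subst word_on_tape_of_nat)
     (simp add: length_input_word, simp add: input_word_def enc_nat_def nth_append length_mat)

lemma step_copy_size:
  assumes "i < n"
  shows "step M (0, [(F, int i), (ruler i 0 False, int i), (ruler i 0 False, int i),
      (ruler i 0 False, int i), (ruler i 0 False, int i), (r, xr), (s, xs), (m, xm),
      (word_on_tape (replicate i True), int i)]) =
    (0, [(F, int (Suc i)), (ruler (Suc i) 0 False, int (Suc i)), (ruler (Suc i) 0 False, int (Suc i)),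
      (ruler (Suc i) 0 False, int (Suc i)), (ruler (Suc i) 0 False, int (Suc i)), (r, xr), (s, xs),
      (m, xm), (word_on_tape (replicate (Suc i) True), int (Suc i))])"
  using F_size(1)[OF assms] word_on_tape_snoc[of "replicate i True" True]
  by (simp add: step_machine transition_def fun_upd_idem ruler_extend replicate_append_same)

lemma reach_setup:
  "reach M (n * n + 2 * n + 3 * k + 7) (initial_config M input_word)
    (6, [(F, int (n + n * n)), (ruler n k True, 0), (ruler n k True, 0), (ruler n k True, 0),
      (ruler n k True, 0), (pos_multiples k 0, 0), (neg_multiples k 0, 0), (blank, 0),
      (word_on_tape (enc_nat n), int (Suc n))])"
proof -
  let ?u = "(word_on_tape (enc_nat n), int (Suc n))"
  let ?R = "ruler n 0 False" and ?S = "ruler n k True"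
  have "reach M (Suc n) (0, [(F, int 0), (ruler 0 0 False, int 0), (ruler 0 0 False, int 0),
      (ruler 0 0 False, int 0), (ruler 0 0 False, int 0), (blank, 0), (blank, 0), (blank, 0),
      (word_on_tape (replicate 0 True), int 0)])
    (1, [(F, int (Suc n)), (?R, int n - 1), (?R, int n - 1), (?R, int n - 1), (?R, int n - 1),
      (blank, 0), (blank, 0), (blank, 0), ?u])" (is "reach _ _ ?c0 ?c1")
    apply (rule reach_while[where c = "\<lambda>i. (0, [(F, int i), (ruler i 0 False, int i),
      (ruler i 0 False, int i), (ruler i 0 False, int i), (ruler i 0 False, int i), (blank, 0),
      (blank, 0), (blank, 0), (word_on_tape (replicate i True), int i)])"])
    subgoal by (rule step_copy_size)
    subgoal using F_size(2) word_on_tape_snoc[of "replicate n True" False]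
      by (simp add: step_machine transition_def fun_upd_idem ruler_def enc_nat_def)
    done
  moreover have "initial_config M input_word = ?c0"
    by (simp add: initial_config_machine blank_eq_ruler)
  ultimately have "reach M (Suc n) (initial_config M input_word) ?c1"
    by simp
  also have "reach M (Suc n)
    (1, [(F, int (Suc n)), (?R, int n - 1), (?R, int n - 1), (?R, int n - 1), (?R, int n - 1),
      (blank, 0), (blank, 0), (blank, 0), ?u])
    (2, [(F, int (Suc n)), (?R, 0), (?R, 0), (?R, 0), (?R, 0),
      (blank, 0), (blank, 0), (blank, 0), ?u])"
    using reach_while[where m = n and M = M and c' =
      "(2, [(F, int (Suc n)), (?R, 0), (?R, 0), (?R, 0), (?R, 0), (blank, 0), (blank, 0), (blank, 0), ?u])"
      and c = "\<lambda>i. (1, [(F, int (Suc n)), (?R, int n - 1 - int i), (?R, int n - 1 - int i),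
        (?R, int n - 1 - int i), (?R, int n - 1 - int i), (blank, 0), (blank, 0), (blank, 0), ?u])"]
    by (simp add: step_machine transition_def fun_upd_idem ruler_def)
  also have "reach M (Suc (n * n + k + 1))
    (2, [(F, int (Suc n)), (?R, 0), (?R, 0), (?R, 0), (?R, 0),
      (blank, 0), (blank, 0), (blank, 0), ?u])
    (3, [(F, int (n + 1 + n * n + k)), (?R, 0), (?R, 0), (?R, 0), (?R, 0),
      (blank, 0), (blank, 0), (blank, 0), ?u])"
    using reach_while[where m = "n * n + k + 1" and M = M and c' =
      "(3, [(F, int (n + 1 + n * n + k)), (?R, 0), (?R, 0), (?R, 0), (?R, 0),
        (blank, 0), (blank, 0), (blank, 0), ?u])"
      and c = "\<lambda>i. (2, [(F, int (n + 1 + i)), (?R, 0), (?R, 0), (?R, 0), (?R, 0),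
        (blank, 0), (blank, 0), (blank, 0), ?u])"] F_end
      F_nonblank[of "n + 1 + i" for i]
    by (simp add: step_machine transition_def fun_upd_idem add_ac)
  also have "reach M (Suc 0)
    (3, [(F, int (n + 1 + n * n + k)), (?R, 0), (?R, 0), (?R, 0), (?R, 0),
      (blank, 0), (blank, 0), (blank, 0), ?u])
    (4, [(F, int (n + n * n + k)), (?R, 0), (?R, 0), (?R, 0), (?R, 0),
      (blank, 0), (blank, 0), (blank, 0), ?u])"
    by (rule reach_step) (simp add: step_machine transition_def)
  also have "reach M (Suc k)
    (4, [(F, int (n + n * n + k)), (?R, 0), (?R, 0), (?R, 0), (?R, 0),
      (blank, 0), (blank, 0), (blank, 0), ?u])
    (5, [(F, int (n + n * n)), (?S, int k - 1), (?S, int k - 1), (?S, int k - 1), (?S, int k - 1),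
      (blank, 0), (blank, 0), (blank, 0), ?u])"
  proof -
    let ?c = "\<lambda>i. (4, [(F, int (n + n * n + k) - int i), (ruler n i False, int i),
      (ruler n i False, int i), (ruler n i False, int i), (ruler n i False, int i),
      (blank, 0), (blank, 0), (blank, 0), ?u])"
    have "step M (?c i) = ?c (Suc i)" if "i < k" for i
    proof -
      have "int (n + n * n + k) - int i = int (n + 1 + n * n + (k - 1 - i))"
        using that by simp
      then have "F (int (n + n * n + k) - int i) = 2"
        using F_param[of "k - 1 - i"] that by (simp only:) simp
      then show ?thesis
        using that k_le by (simp add: step_machine transition_def fun_upd_idem ruler_mark)
    qed
    moreover have "step M (?c k) = (5, [(F, int (n + n * n)), (?S, int k - 1), (?S, int k - 1),
        (?S, int k - 1), (?S, int k - 1), (blank, 0), (blank, 0), (blank, 0), ?u])"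
      using F_before_param ruler_top k_le
      by (cases "k = n") (auto simp: step_machine transition_def ruler_def)
    ultimately show ?thesis
      using reach_while[of k M ?c] by simp
  qed
  also have "reach M (Suc k)
    (5, [(F, int (n + n * n)), (?S, int k - 1), (?S, int k - 1), (?S, int k - 1), (?S, int k - 1),
      (blank, 0), (blank, 0), (blank, 0), ?u])
    (6, [(F, int (n + n * n)), (?S, 0), (?S, 0), (?S, 0), (?S, 0), (pos_multiples k 0, 0),
      (neg_multiples k 0, 0), (blank, 0), ?u])"
    using reach_while[where m = k and M = M and c' =
      "(6, [(F, int (n + n * n)), (?S, 0), (?S, 0), (?S, 0), (?S, 0), (blank(0 := 2), 0),
        (blank, 0), (blank, 0), ?u])"
      and c = "\<lambda>i. (5, [(F, int (n + n * n)), (?S, int k - 1 - int i), (?S, int k - 1 - int i),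
        (?S, int k - 1 - int i), (?S, int k - 1 - int i), (blank, 0), (blank, 0), (blank, 0), ?u])"]
      k_le
    by (simp add: step_machine transition_def fun_upd_idem ruler_def pos_multiples_0[of k, symmetric]
        blank_eq_neg_multiples[of k, symmetric])
  finally show ?thesis
    by (rule reach_mono) simp
qed

section \<open>Marking the multiples of k and charging the budget\<close>

abbreviation "S \<equiv> ruler n k True"

text \<open>Before the next multiple is charged, the counter is as long as the price minus one; the
  last unit is charged together with the extension of the counter.\<close>

definition counter :: "nat \<Rightarrow> int \<Rightarrow> nat" where
  "counter j = ruler (if ed then j else 0) 0 False"

text \<open>The invariant of the scan. The budget head only moves forward, so its position is the
  total price so far.\<close>

definition scan_config :: "tape \<Rightarrow> nat \<Rightarrow> config" where
  "scan_config u x =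
     (6, [(F, int (n + n * n)), (S, int x), (S, 0), (S, int (x mod k)), (S, int (cost ed (x div k))),
       (pos_multiples k x, int x), (neg_multiples k x, - int x), (counter (x div k), 0), u])"

text \<open>Used with the full length of the counter when the multiple can be paid, and with the
  remaining credit when it cannot.\<close>

lemma reach_run:
  assumes "t \<le> (if ed then j else 0)" "cost ed j + t \<le> k"
  shows "reach M t
    (8, [(F, p), (S, xa), (S, xb), (S, xc), (S, int (cost ed j)), (r, xr), (s, xs), (counter j, 0), u])
    (8, [(F, p), (S, xa), (S, xb), (S, xc), (S, int (cost ed j + t)), (r, xr), (s, xs),
      (counter j, int t), u])"
proof -
  obtain fu xu where u: "u = (fu, xu)" by (cases u)
  show ?thesis
    using reach_loop[of t M "Suc 0" "\<lambda>i. (8, [(F, p), (S, xa), (S, xb), (S, xc),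
      (S, int (cost ed j + i)), (r, xr), (s, xs), (counter j, int i), (fu, xu)])"] assms k_le
    by (simp add: u reach_step step_machine transition_def fun_upd_idem ruler_def counter_def
        split: if_splits)
qed

lemma scan_step_skip:
  assumes "x < n" "Suc (x mod k) < k"
  shows "reach M 2 (scan_config u x) (scan_config u (Suc x))"
proof -
  obtain fu xu where u: "u = (fu, xu)" by (cases u)
  have eq: "Suc x mod k = Suc (x mod k)" "Suc x div k = x div k"
    using assms(2) by (simp_all add: mod_Suc div_Suc)
  then have nd: "\<not> k dvd Suc x"
    by (simp add: dvd_eq_mod_eq_0)
  have "reach M (Suc 0) (scan_config u x)
    (7, [(F, int (n + n * n)), (S, int (Suc x)), (S, 0), (S, int (Suc (x mod k))),
       (S, int (cost ed (x div k))), (pos_multiples k x, int (Suc x)),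
       (neg_multiples k x, - int (Suc x)), (counter (x div k), 0), u])"
    using assms by (intro reach_step)
      (simp add: scan_config_def u step_machine transition_def fun_upd_idem ruler_def)
  also have "reach M (Suc 0) \<dots> (scan_config u (Suc x))"
    using assms k_le by (intro reach_step)
      (simp add: scan_config_def u step_machine transition_def fun_upd_idem ruler_def eq
        multiples_Suc_not[OF nd])
  finally show ?thesis by (simp add: numeral_2_eq_2)
qed

lemma scan_step_hit:
  assumes "x < n" "k \<le> Suc (x mod k)"
  shows "reach M 2 (scan_config u x)
    (8, [(F, int (n + n * n)), (S, int (Suc x)), (S, 0), (S, int (Suc (x mod k))),
       (S, int (cost ed (x div k))), ((pos_multiples k x)(int (Suc x) := 1), int (Suc x)),
       ((neg_multiples k x)(- int (Suc x) := 1), - int (Suc x)), (counter (x div k), 0), u])"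
proof -
  obtain fu xu where u: "u = (fu, xu)" by (cases u)
  have "reach M (Suc 0) (scan_config u x)
    (7, [(F, int (n + n * n)), (S, int (Suc x)), (S, 0), (S, int (Suc (x mod k))),
       (S, int (cost ed (x div k))), (pos_multiples k x, int (Suc x)),
       (neg_multiples k x, - int (Suc x)), (counter (x div k), 0), u])"
    using assms by (intro reach_step)
      (simp add: scan_config_def u step_machine transition_def fun_upd_idem ruler_def)
  also have "reach M (Suc 0) \<dots>
    (8, [(F, int (n + n * n)), (S, int (Suc x)), (S, 0), (S, int (Suc (x mod k))),
       (S, int (cost ed (x div k))), ((pos_multiples k x)(int (Suc x) := 1), int (Suc x)),
       ((neg_multiples k x)(- int (Suc x) := 1), - int (Suc x)), (counter (x div k), 0), u])"
    using assms k_le by (intro reach_step)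
      (simp add: u step_machine transition_def fun_upd_idem ruler_def)
  finally show ?thesis by (simp add: numeral_2_eq_2)
qed

text \<open>The second assumption is what the ruler reports when it shows no symbol \<open>2\<close>
  after the move. For \<open>k = 0\<close> it always holds, so positivity of \<open>k\<close> has to
  be assumed separately.\<close>

lemma last_residue:
  assumes "0 < k" "k \<le> Suc (x mod k)"
  shows "x mod k = k - 1" "Suc x mod k = 0" "Suc x div k = Suc (x div k)"
    "Suc (x div k) * k = Suc x"
proof -
  have "x mod k < k"
    using assms(1) by simp
  then have eq: "Suc (x mod k) = k"
    using assms(2) by simp
  then show "x mod k = k - 1" "Suc x mod k = 0" "Suc x div k = Suc (x div k)"
    by (simp_all add: mod_Suc div_Suc)
  then show "Suc (x div k) * k = Suc x"
    by (metis add.right_neutral div_mult_mod_eq)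
qed

text \<open>The time is 2 for the marks, \<open>l\<close> and 1 for the payment,
  \<open>l + 1\<close> and \<open>k + 1\<close> for rewinding the counter and the counter modulo
  \<open>k\<close>, where \<open>l < k\<close>.\<close>

lemma scan_step_count:
  assumes "x < n" "k \<le> Suc (x mod k)" "cost ed (Suc (x div k)) \<le> k"
  shows "reach M (3 * k + 5) (scan_config u x) (scan_config u (Suc x))"
proof -
  obtain fu xu where u: "u = (fu, xu)" by (cases u)
  define j where "j = x div k"
  define l where "l = (if ed then j else 0)"
  have l: "cost ed j + l < k"
    using assms(3) by (simp only: cost_Suc j_def l_def)
  then have "0 < k" by simp
  note res = last_residue[OF this assms(2)]
  have dvd: "k dvd Suc x"
    using res(2) by (simp add: dvd_eq_mod_eq_0)
  let ?P = "pos_multiples k (Suc x)" and ?N = "neg_multiples k (Suc x)"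
  have "reach M 2 (scan_config u x)
    (8, [(F, int (n + n * n)), (S, int (Suc x)), (S, 0), (S, int k), (S, int (cost ed j)),
       (?P, int (Suc x)), (?N, - int (Suc x)), (counter j, 0), u])"
    using scan_step_hit[OF assms(1,2), of u] multiples_Suc[OF dvd] res(1) \<open>0 < k\<close>
    by (simp add: j_def)
  also have "reach M l \<dots>
    (8, [(F, int (n + n * n)), (S, int (Suc x)), (S, 0), (S, int k), (S, int (cost ed j + l)),
       (?P, int (Suc x)), (?N, - int (Suc x)), (counter j, int l), u])"
    using l by (intro reach_run) (auto simp: l_def)
  also have "reach M (Suc 0) \<dots>
    (9, [(F, int (n + n * n)), (S, int (Suc x)), (S, 0), (S, int k), (S, int (cost ed (Suc j))),
       (?P, int (Suc x)), (?N, - int (Suc x)), (counter (Suc j), int l - 1), u])"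
  proof (rule reach_step)
    have "counter j (int l) = 0"
      by (simp add: counter_def ruler_def l_def)
    moreover have "(counter j)(int l := if ed then Suc 0 else 0) = counter (Suc j)"
      using ruler_extend by (auto simp: counter_def l_def fun_upd_idem ruler_def)
    moreover have "S (int (cost ed j + l)) = 2"
      using l k_le by (simp add: ruler_def)
    ultimately show "step M
      (8, [(F, int (n + n * n)), (S, int (Suc x)), (S, 0), (S, int k), (S, int (cost ed j + l)),
       (?P, int (Suc x)), (?N, - int (Suc x)), (counter j, int l), u]) =
      (9, [(F, int (n + n * n)), (S, int (Suc x)), (S, 0), (S, int k), (S, int (cost ed (Suc j))),
       (?P, int (Suc x)), (?N, - int (Suc x)), (counter (Suc j), int l - 1), u])"
      by (cases ed) (simp_all add: u step_machine transition_def Let_def fun_upd_idem cost_Suc l_def)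
  qed
  also have "reach M (Suc l) \<dots>
    (10, [(F, int (n + n * n)), (S, int (Suc x)), (S, 0), (S, int k - 1), (S, int (cost ed (Suc j))),
       (?P, int (Suc x)), (?N, - int (Suc x)), (counter (Suc j), 0), u])"
    using reach_while[where m = l and M = M and c' = "(10, [(F, int (n + n * n)),
        (S, int (Suc x)), (S, 0), (S, int k - 1), (S, int (cost ed (Suc j))),
        (?P, int (Suc x)), (?N, - int (Suc x)), (counter (Suc j), 0), (fu, xu)])" and
      c = "\<lambda>i. (9, [(F, int (n + n * n)), (S, int (Suc x)), (S, 0), (S, int k),
        (S, int (cost ed (Suc j))), (?P, int (Suc x)), (?N, - int (Suc x)),
        (counter (Suc j), int l - 1 - int i), (fu, xu)])"]
    by (simp add: u step_machine transition_def fun_upd_idem counter_def ruler_def l_def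
        split: if_splits)
  also have "reach M (Suc k) \<dots> (scan_config u (Suc x))"
    using reach_while[where m = k and M = M and c' = "scan_config u (Suc x)" and
      c = "\<lambda>i. (10, [(F, int (n + n * n)), (S, int (Suc x)), (S, 0), (S, int k - 1 - int i),
        (S, int (cost ed (Suc j))), (?P, int (Suc x)), (?N, - int (Suc x)),
        (counter (Suc j), 0), (fu, xu)])"] k_le res
    by (simp add: u step_machine transition_def fun_upd_idem ruler_def scan_config_def j_def)
  finally show ?thesis
    using l by (elim reach_mono) simp
qed

text \<open>The heads of the modulo, budget and counter tapes are left where the scan stopped. The
  mode is whatever stands under the counter head, wherever that is.\<close>

definition rewind_config :: "tape \<Rightarrow> nat \<Rightarrow> nat \<Rightarrow> (int \<Rightarrow> nat) \<Rightarrow> (int \<Rightarrow> nat) \<Rightarrow> config \<Rightarrow> bool" where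
  "rewind_config u v x R N c \<longleftrightarrow>
     (\<exists>xc xd Q xq. Q xq = v \<and> c = (11, [(F, int (n + n * n)), (S, int x - 1), (S, 0), (S, xc),
        (S, xd), (R, int x - 1), (N, 1 - int x), (Q, xq), u]))"

lemma scan_step_overflow:
  assumes "x < n" "k \<le> Suc (x mod k)" "cost ed (x div k) \<le> k" "k < cost ed (Suc (x div k))"
  shows "\<exists>c R N. reach M (k + 3) (scan_config u x) c \<and> rewind_config u 1 (Suc x) R N c \<and>
    (\<forall>y. R y = 2 \<longleftrightarrow> y = 0)"
proof -
  obtain fu xu where u: "u = (fu, xu)" by (cases u)
  define j where "j = x div k"
  \<comment> \<open>The remaining credit: the budget head gets to cell \<open>k\<close>, the first
    one without symbol \<open>2\<close>, possibly while the counter is only partly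
    traversed.\<close>
  define t where "t = k - cost ed j"
  have t: "t \<le> (if ed then j else 0)" "cost ed j + t = k"
    using assms(3,4) by (auto simp: t_def j_def cost_Suc)
  let ?R = "(pos_multiples k x)(int (Suc x) := 1)" and ?N = "(neg_multiples k x)(- int (Suc x) := 1)"
  have "reach M 2 (scan_config u x)
    (8, [(F, int (n + n * n)), (S, int (Suc x)), (S, 0), (S, int (Suc (x mod k))),
       (S, int (cost ed j)), (?R, int (Suc x)), (?N, - int (Suc x)), (counter j, 0), u])"
    unfolding j_def by (rule scan_step_hit) fact+
  also have "reach M t \<dots>
    (8, [(F, int (n + n * n)), (S, int (Suc x)), (S, 0), (S, int (Suc (x mod k))),
       (S, int (cost ed j + t)), (?R, int (Suc x)), (?N, - int (Suc x)), (counter j, int t), u])"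
    by (rule reach_run) (use t in auto)
  also have "reach M (Suc 0) \<dots>
    (11, [(F, int (n + n * n)), (S, int (Suc x) - 1), (S, 0), (S, int (Suc (x mod k))),
       (S, int k), (?R, int (Suc x) - 1), (?N, 1 - int (Suc x)),
       ((counter j)(int t := 1), int t), u])"
    unfolding t(2) by (rule reach_step)
      (simp add: u step_machine transition_def ruler_def fun_upd_idem)
  finally have "reach M (k + 3) (scan_config u x)
    (11, [(F, int (n + n * n)), (S, int (Suc x) - 1), (S, 0), (S, int (Suc (x mod k))),
       (S, int k), (?R, int (Suc x) - 1), (?N, 1 - int (Suc x)),
       ((counter j)(int t := 1), int t), u])"
    by (rule reach_mono) (simp add: t_def)
  \<comment> \<open>Mode \<open>1\<close> consults the marks only for the diagonal symbol
    \<open>2\<close> in cell 0, which the mark just written at a positive cell cannot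
    affect.\<close>
  moreover have "\<forall>y. ?R y = 2 \<longleftrightarrow> y = 0"
    by (simp add: pos_multiples_def)
  ultimately show ?thesis
    unfolding rewind_config_def by (intro exI conjI) (assumption | rule fun_upd_same refl)+
qed

text \<open>For \<open>n = k = 0\<close> the second conjunct holds with \<open>q = 1\<close>, but
  nil would be wrong: the empty partition is a solution.\<close>

definition overflow :: bool where
  "overflow \<longleftrightarrow> 0 < n \<and> (\<exists>q. q * k \<le> n \<and> k < cost ed q)"

text \<open>Once the budget is exceeded the scan is over, and later induction steps only relax the
  time bound. For \<open>k = 0\<close> this happens at the first cell, which explains the last
  conjunct.\<close>

lemma reach_scan:
  assumes "x \<le> n"
  shows "(overflow \<and> (\<exists>c y R N. y \<le> n \<and> reach M (x * (3 * k + 5)) (scan_config u 0) c \<and>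
            rewind_config u 1 y R N c \<and> (\<forall>y. R y = 2 \<longleftrightarrow> y = 0))) \<or>
         (reach M (x * (3 * k + 5)) (scan_config u 0) (scan_config u x) \<and>
            cost ed (x div k) \<le> k \<and> (k = 0 \<longrightarrow> x = 0))"
  using assms
proof (induction x)
  case 0
  then show ?case by (simp add: reach_refl cost_0)
next
  case (Suc x)
  then consider
      (over) c y R N where "overflow" "y \<le> n" "reach M (x * (3 * k + 5)) (scan_config u 0) c"
        "rewind_config u 1 y R N c" "\<forall>y. R y = 2 \<longleftrightarrow> y = 0"
    | (run) "reach M (x * (3 * k + 5)) (scan_config u 0) (scan_config u x)"
        "cost ed (x div k) \<le> k" "k = 0 \<longrightarrow> x = 0"
    by auto
  then show ?case
  proof cases
    case over
    then have "reach M (Suc x * (3 * k + 5)) (scan_config u 0) c"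
      by (elim reach_mono) simp
    with over show ?thesis by blast
  next
    case run
    consider (skip) "Suc (x mod k) < k"
      | (count) "k \<le> Suc (x mod k)" "cost ed (Suc (x div k)) \<le> k"
      | (overflow) "k \<le> Suc (x mod k)" "k < cost ed (Suc (x div k))"
      by linarith
    then show ?thesis
    proof cases
      case skip
      have "reach M 2 (scan_config u x) (scan_config u (Suc x))"
        using Suc.prems skip by (intro scan_step_skip) simp_all
      from reach_trans[OF run(1) this]
      have "reach M (Suc x * (3 * k + 5)) (scan_config u 0) (scan_config u (Suc x))"
        by (rule reach_mono) simp
      moreover have "Suc x div k = x div k"
        using skip by (simp add: div_Suc mod_Suc)
      ultimately show ?thesis
        using run(2) skip by auto
    next
      case count
      have "reach M (3 * k + 5) (scan_config u x) (scan_config u (Suc x))"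
        using Suc.prems count by (intro scan_step_count) simp_all
      from reach_trans[OF run(1) this]
      have "reach M (Suc x * (3 * k + 5)) (scan_config u 0) (scan_config u (Suc x))"
        by (rule reach_mono) simp
      moreover have "0 < k"
        using count(2) by (simp add: cost_Suc)
      ultimately show ?thesis
        using count last_residue by simp
    next
      case overflow
      obtain c R N where *: "reach M (k + 3) (scan_config u x) c"
        "rewind_config u 1 (Suc x) R N c" "\<forall>y. R y = 2 \<longleftrightarrow> y = 0"
        using scan_step_overflow[OF _ overflow(1) run(2) overflow(2), of u] Suc.prems by auto
      from reach_trans[OF run(1) *(1)]
      have "reach M (Suc x * (3 * k + 5)) (scan_config u 0) c"
        by (rule reach_mono) simp
      moreover have "Suc (x div k) * k \<le> n"
        using last_residue(4)[OF _ overflow(1)] Suc.prems by (cases "k = 0") auto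
      then have "overflow"
        using overflow(2) Suc.prems unfolding overflow_def by (intro conjI exI[of _ "Suc (x div k)"]) simp_all
      ultimately show ?thesis
        using *(2,3) Suc.prems by blast
    qed
  qed
qed

end


section \<open>Writing the output\<close>

context machine_run
begin

lemma reach_scan_end:
  "\<exists>c R N v y. reach M (n * (3 * k + 5) + 1) (scan_config u 0) c \<and>
     rewind_config u v y R N c \<and> y \<le> n \<and> (\<forall>y. R y = 2 \<longleftrightarrow> y = 0) \<and>
     (overflow \<and> v = 1 \<or> v = 2 \<and> cost ed (n div k) \<le> k \<and> (k = 0 \<longrightarrow> n = 0) \<and>
        R = pos_multiples k n \<and> N = neg_multiples k n)"
  using reach_scan[of n u, OF order_refl]
proof (elim disjE conjE exE, goal_cases)
  case (1 c y R N)
  then have "reach M (n * (3 * k + 5) + 1) (scan_config u 0) c"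
    by (elim reach_mono) simp
  with 1 show ?thesis by blast
next
  case 2
  obtain fu xu where u: "u = (fu, xu)" by (cases u)
  note 2(1)
  \<comment> \<open>The blank behind the ruler ends the scan, and mode \<open>2\<close> is written
    into the first counter cell.\<close>
  also have "reach M (Suc 0) (scan_config u n)
    (11, [(F, int (n + n * n)), (S, int n - 1), (S, 0), (S, int (n mod k)),
      (S, int (cost ed (n div k))), (pos_multiples k n, int n - 1),
      (neg_multiples k n, 1 - int n), ((counter (n div k))(0 := 2), 0), u])"
    by (rule reach_step)
      (simp add: scan_config_def u step_machine transition_def ruler_def fun_upd_idem)
  finally have "reach M (n * (3 * k + 5) + 1) (scan_config u 0)
    (11, [(F, int (n + n * n)), (S, int n - 1), (S, 0), (S, int (n mod k)),
      (S, int (cost ed (n div k))), (pos_multiples k n, int n - 1),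
      (neg_multiples k n, 1 - int n), ((counter (n div k))(0 := 2), 0), u])"
    by simp
  moreover have "\<forall>y. pos_multiples k n y = 2 \<longleftrightarrow> y = 0"
    by (simp add: pos_multiples_def)
  ultimately show ?thesis
    using 2(2,3) unfolding rewind_config_def
    by (intro exI[of _ "pos_multiples k n"] exI[of _ "neg_multiples k n"] exI[of _ n] exI[of _ 2]
        exI conjI disjI2) (assumption | rule fun_upd_same refl order_refl)+
qed

lemma reach_rewind:
  assumes "rewind_config (fu, xu) v y R N c" "y \<le> n"
  shows "\<exists>xc xd Q xq. Q xq = v \<and> reach M (n * n + 4 * n + 5) c
    (14, [(F, int (n + 1)), (S, 0), (S, 0), (S, xc), (S, xd), (R, 0), (N, 0), (Q, xq), (fu, xu)])"
proof -
  obtain xc xd Q xq where Q: "Q xq = v" and c: "c = (11, [(F, int (n + n * n)), (S, int y - 1),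
      (S, 0), (S, xc), (S, xd), (R, int y - 1), (N, 1 - int y), (Q, xq), (fu, xu)])"
    using assms(1) unfolding rewind_config_def by auto
  have "reach M (Suc y) c
    (12, [(F, int (n + n * n)), (S, 0), (S, 0), (S, xc), (S, xd), (R, 0), (N, 0), (Q, xq), (fu, xu)])"
    using reach_while[where m = y and M = M and c' = "(12, [(F, int (n + n * n)), (S, 0),
        (S, 0), (S, xc), (S, xd), (R, 0), (N, 0), (Q, xq), (fu, xu)])" and
      c = "\<lambda>i. (11, [(F, int (n + n * n)), (S, int y - 1 - int i), (S, 0), (S, xc), (S, xd),
        (R, int y - 1 - int i), (N, 1 - int y + int i), (Q, xq), (fu, xu)])"] assms(2)
    by (simp add: c step_machine transition_def fun_upd_idem ruler_def)
  also have "reach M (Suc (n + n * n + 1)) \<dots>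
    (13, [(F, 0), (S, 0), (S, 0), (S, xc), (S, xd), (R, 0), (N, 0), (Q, xq), (fu, xu)])"
  proof -
    let ?c = "\<lambda>i. (12, [(F, int (n + n * n) - int i), (S, 0), (S, 0), (S, xc), (S, xd), (R, 0),
        (N, 0), (Q, xq), (fu, xu)])"
    have "step M (?c i) = ?c (Suc i)" if "i < n + n * n + 1" for i
    proof -
      have "int (n + n * n) - int i = int (n + n * n - i)"
        using that by linarith
      then have "F (int (n + n * n) - int i) \<noteq> 0"
        using F_nonblank[of "n + n * n - i"] that by simp
      then show ?thesis
        by (simp add: step_machine transition_def fun_upd_idem)
    qed
    moreover have "step M (?c (n + n * n + 1)) =
        (13, [(F, 0), (S, 0), (S, 0), (S, xc), (S, xd), (R, 0), (N, 0), (Q, xq), (fu, xu)])"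
      by (simp add: step_machine transition_def fun_upd_idem word_on_tape_negative)
    ultimately show ?thesis
      using reach_while[of "n + n * n + 1" M ?c] by simp
  qed
  also have "reach M (Suc n) \<dots>
    (14, [(F, int (n + 1)), (S, 0), (S, 0), (S, xc), (S, xd), (R, 0), (N, 0), (Q, xq), (fu, xu)])"
    using reach_while[where m = n and M = M and c' = "(14, [(F, int (n + 1)), (S, 0),
        (S, 0), (S, xc), (S, xd), (R, 0), (N, 0), (Q, xq), (fu, xu)])" and
      c = "\<lambda>i. (13, [(F, int i), (S, 0), (S, 0), (S, xc), (S, xd), (R, 0), (N, 0), (Q, xq), (fu, xu)])"]
      F_size
    by (simp add: step_machine transition_def fun_upd_idem)
  finally have "reach M (n * n + 4 * n + 5) c
    (14, [(F, int (n + 1)), (S, 0), (S, 0), (S, xc), (S, xd), (R, 0), (N, 0), (Q, xq), (fu, xu)])"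
    by (rule reach_mono) (use assms(2) in simp)
  with Q show ?thesis by blast
qed

section \<open>Rows of bits written under the guidance of the marks\<close>

definition bit_rows :: "(nat \<Rightarrow> nat \<Rightarrow> bool) \<Rightarrow> nat \<Rightarrow> bool list" where
  "bit_rows entry m = concat (map (\<lambda>i. map (entry i) [0..<n]) [0..<m])"

lemma bit_rows_Suc: "bit_rows entry (Suc m) = bit_rows entry m @ map (entry m) [0..<n]"
  by (simp add: bit_rows_def)

abbreviation output_tape :: "bool list \<Rightarrow> tape" where
  "output_tape ys \<equiv> (word_on_tape ys, int (length ys))"

text \<open>The mark heads make \<open>n\<close> moves to the right while writing and
  \<open>n + 1\<close> to the left afterwards. They end one cell further left than they began, at
  \<open>- (i + 1)\<close>, the value of \<open>j - i\<close> for the first entry of the next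
  row.\<close>

lemma reach_row:
  assumes "i < n" "v = 3 \<Longrightarrow> i < k" "Q xq = v"
    and entry: "\<And>j. j < n \<Longrightarrow> cell_symbol col v (F (p + int j)) (S (int i)) (S (int j))
      (R (int j - int i)) (N (int j - int i)) = (if entry j then 2 else 1)"
  shows "reach M (2 * n + 3)
    (14, [(F, p), (S, int i), (S, 0), (S, xc), (S, xd), (R, - int i), (N, - int i), (Q, xq),
      output_tape ys])
    (14, [(F, p + int n), (S, int (Suc i)), (S, 0), (S, xc), (S, xd), (R, - int (Suc i)),
      (N, - int (Suc i)), (Q, xq), output_tape (ys @ map entry [0..<n])])"
proof -
  let ?ys = "ys @ map entry [0..<n]"
  have S: "S (int i) \<noteq> 0" "v = 3 \<Longrightarrow> S (int i) = 2"
    using assms(1,2) by (simp_all add: ruler_def)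
  have "reach M (Suc n)
    (14, [(F, p), (S, int i), (S, 0), (S, xc), (S, xd), (R, - int i), (N, - int i), (Q, xq),
      output_tape ys])
    (15, [(F, p + int n), (S, int i), (S, int n - 1), (S, xc), (S, xd), (R, int n - 1 - int i),
      (N, int n - 1 - int i), (Q, xq), output_tape ?ys])"
  proof -
    let ?c = "\<lambda>j. (14, [(F, p + int j), (S, int i), (S, int j), (S, xc), (S, xd),
      (R, int j - int i), (N, int j - int i), (Q, xq), output_tape (ys @ map entry [0..<j])])"
    have "step M (?c j) = ?c (Suc j)" if "j < n" for j
    proof -
      have "S (int j) \<noteq> 0"
        using that by (simp add: ruler_def)
      then show ?thesis
        using S assms(3) entry[OF that] word_on_tape_snoc[of "ys @ map entry [0..<j]" "entry j"]
        by (simp add: step_machine transition_def fun_upd_idem)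
    qed
    moreover have "step M (?c n) = (15, [(F, p + int n), (S, int i), (S, int n - 1), (S, xc),
        (S, xd), (R, int n - 1 - int i), (N, int n - 1 - int i), (Q, xq), output_tape ?ys])"
    proof -
      have "S (int n) = 0"
        by (simp add: ruler_def)
      then show ?thesis
        using S assms(3) by (simp add: step_machine transition_def fun_upd_idem)
    qed
    ultimately show ?thesis
      using reach_while[of n M ?c] by simp
  qed
  also have "reach M (Suc n) \<dots>
    (14, [(F, p + int n), (S, int (Suc i)), (S, 0), (S, xc), (S, xd), (R, - int (Suc i)),
      (N, - int (Suc i)), (Q, xq), output_tape ?ys])"
    using reach_while[where m = n and M = M and c' = "(14, [(F, p + int n), (S, int (Suc i)), (S, 0),
        (S, xc), (S, xd), (R, - int (Suc i)), (N, - int (Suc i)), (Q, xq), output_tape ?ys])" and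
      c = "\<lambda>j. (15, [(F, p + int n), (S, int i), (S, int n - 1 - int j), (S, xc), (S, xd),
        (R, int n - 1 - int i - int j), (N, int n - 1 - int i - int j), (Q, xq), output_tape ?ys])"]
    by (simp add: step_machine transition_def fun_upd_idem ruler_def)
  finally show ?thesis
    by (rule reach_mono) simp
qed

text \<open>Serves twice: with \<open>m = n\<close> for the adjacency matrix, and with
  \<open>m = k\<close> for the characteristic vectors of the classes.\<close>

lemma reach_rows:
  assumes "m \<le> n" "v = 3 \<Longrightarrow> m \<le> k" "Q xq = v"
    and entry: "\<And>i j. i < m \<Longrightarrow> j < n \<Longrightarrow> cell_symbol col v (F (p + int (i * n + j))) (S (int i))
      (S (int j)) (R (int j - int i)) (N (int j - int i)) = (if entry i j then 2 else 1)"
  shows "reach M (m * (2 * n + 3))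
    (14, [(F, p), (S, 0), (S, 0), (S, xc), (S, xd), (R, 0), (N, 0), (Q, xq), output_tape ys])
    (14, [(F, p + int (m * n)), (S, int m), (S, 0), (S, xc), (S, xd), (R, - int m),
      (N, - int m), (Q, xq), output_tape (ys @ bit_rows entry m)])"
proof -
  let ?c = "\<lambda>i. (14, [(F, p + int (i * n)), (S, int i), (S, 0), (S, xc), (S, xd), (R, - int i),
      (N, - int i), (Q, xq), output_tape (ys @ bit_rows entry i)])"
  have "reach M (2 * n + 3) (?c i) (?c (Suc i))" if "i < m" for i
  proof -
    have eq: "p + int (i * n) + int n = p + int (Suc i * n)"
      "(ys @ bit_rows entry i) @ map (entry i) [0..<n] = ys @ bit_rows entry (Suc i)"
      by (simp_all add: bit_rows_Suc)
    show ?thesis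
      by (rule reach_row[of i v Q xq "p + int (i * n)" R N "entry i" xc xd "ys @ bit_rows entry i",
        unfolded eq]) (use assms that in \<open>auto simp: add.assoc\<close>)
  qed
  from reach_loop[of m M _ ?c, OF this] show ?thesis
    by (simp add: bit_rows_def)
qed

text \<open>After the matrix the input head stands exactly on the code of \<open>k\<close>, which is
  copied verbatim. The blank behind it triggers the tag: \<open>False\<close> for nil,
  \<open>True\<close> if parts follow.\<close>

lemma reach_param:
  assumes "v \<noteq> 3" "Q xq = v"
  shows "reach M (k + 3)
    (14, [(F, int (n + 1 + n * n)), (S, int n), (S, 0), (S, xc), (S, xd), (R, - int n),
      (N, - int n), (Q, xq), output_tape ys])
    (if v = 1
     then (18, [(F, int (n + 1 + n * n + k + 1)), (S, int n), (S, 0), (S, xc), (S, xd), (R, - int n),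
      (N, - int n), (Q, xq), output_tape (ys @ enc_nat k @ [False])])
     else (17, [(F, int (n + 1 + n * n + k + 1)), (S, int n - 1), (S, 0), (S, xc), (S, xd),
      (R, 1 - int n), (N, 1 - int n), (Q(xq := 3), xq), output_tape (ys @ enc_nat k @ [True])]))"
    (is "reach M _ ?start ?end")
proof -
  let ?c = "\<lambda>i. (16, [(F, int (n + 1 + n * n + i)), (S, int n), (S, 0), (S, xc), (S, xd), (R, - int n),
      (N, - int n), (Q, xq), output_tape (ys @ take i (enc_nat k))])"
  have len: "length (enc_nat k) = k + 1"
    by (simp add: enc_nat_def)
  have "reach M (Suc 0) ?start (?c 0)"
    using assms
    by (intro reach_step) (simp add: step_machine transition_def fun_upd_idem ruler_def)
  also have "reach M (Suc (k + 1)) (?c 0) ?end"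
  proof (rule reach_while)
    fix i assume i: "i < k + 1"
    have "F (int (n + 1 + n * n + i)) = (if enc_nat k ! i then 2 else 1)"
      using F_param[of i] i by (simp add: enc_nat_def nth_append)
    moreover have "take (Suc i) (enc_nat k) = take i (enc_nat k) @ [enc_nat k ! i]"
      using i by (simp add: take_Suc_conv_app_nth len)
    ultimately show "step M (?c i) = ?c (Suc i)"
      using word_on_tape_snoc[of "ys @ take i (enc_nat k)" "enc_nat k ! i"] i
      by (auto simp: step_machine transition_def fun_upd_idem len)
  next
    have "F (int (n + 1 + n * n + (k + 1))) = 0"
      using F_end by (simp only: add.assoc)
    then show "step M (?c (k + 1)) = ?end"
      using word_on_tape_snoc[of "ys @ enc_nat k" True] word_on_tape_snoc[of "ys @ enc_nat k" False] assms
      by (auto simp: step_machine transition_def fun_upd_idem len add_ac)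
  qed
  finally show ?thesis
    by (rule reach_mono) simp
qed

text \<open>For \<open>i < k\<close>, vertex \<open>j\<close> is in class \<open>i\<close> iff
  \<open>k\<close> divides \<open>j - i\<close>, so the same row writer produces the parts; symbol
  \<open>2\<close> on the row ruler limits it to \<open>k\<close> rows.\<close>

lemma reach_parts:
  assumes large: "k = 0 \<longrightarrow> n = 0"
    and mult: "\<And>y. \<bar>y\<bar> < int n \<Longrightarrow> (R y \<noteq> 0 \<or> N y \<noteq> 0) \<longleftrightarrow> int k dvd y" and "Q xq = 3"
  shows "\<exists>ts. reach M (n + 2 + k * (2 * n + 3))
    (17, [(F, p), (S, int n - 1), (S, 0), (S, xc), (S, xd),
      (R, 1 - int n), (N, 1 - int n), (Q, xq), output_tape ys])
    (18, ts @ [output_tape (ys @ bit_rows (\<lambda>i j. j mod k = i) k)])"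
proof -
  have "reach M (Suc n)
    (17, [(F, p), (S, int n - 1), (S, 0), (S, xc), (S, xd),
      (R, 1 - int n), (N, 1 - int n), (Q, xq), output_tape ys])
    (14, [(F, p), (S, 0), (S, 0), (S, xc), (S, xd), (R, 0), (N, 0), (Q, xq), output_tape ys])"
    using reach_while[where m = n and M = M and c' = "(14, [(F, p), (S, 0), (S, 0), (S, xc),
        (S, xd), (R, 0), (N, 0), (Q, xq), output_tape ys])" and
      c = "\<lambda>i. (17, [(F, p), (S, int n - 1 - int i), (S, 0), (S, xc), (S, xd),
        (R, 1 - int n + int i), (N, 1 - int n + int i), (Q, xq), output_tape ys])"]
    by (simp add: step_machine transition_def fun_upd_idem ruler_def)
  also have "reach M (k * (2 * n + 3)) \<dots>
    (14, [(F, p + int (k * n)), (S, int k), (S, 0), (S, xc), (S, xd), (R, - int k),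
      (N, - int k), (Q, xq), output_tape (ys @ bit_rows (\<lambda>i j. j mod k = i) k)])"
  proof (rule reach_rows)
    fix i j assume ij: "i < k" "j < n"
    then have "\<bar>int j - int i\<bar> < int n"
      using k_le by linarith
    moreover have "int k dvd int j - int i \<longleftrightarrow> j mod k = i"
    proof -
      have "int k dvd int j - int i \<longleftrightarrow> int j mod int k = int i mod int k"
        by (simp add: mod_eq_dvd_iff)
      also have "\<dots> \<longleftrightarrow> j mod k = i mod k"
        by (simp flip: zmod_int)
      finally show ?thesis using ij by simp
    qed
    ultimately show "cell_symbol col 3 (F (p + int (i * n + j))) (S (int i)) (S (int j))
        (R (int j - int i)) (N (int j - int i)) = (if j mod k = i then 2 else 1)"
      using mult[of "int j - int i"] by (simp add: cell_symbol_def)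
  qed (use k_le assms in auto)
  also have "reach M (Suc 0) \<dots>
    (18, [(F, p + int (k * n)), (S, int k), (S, 0), (S, xc), (S, xd), (R, - int k),
      (N, - int k), (Q, xq), output_tape (ys @ bit_rows (\<lambda>i j. j mod k = i) k)])"
    using assms(3) k_le
    by (intro reach_step) (simp add: step_machine transition_def fun_upd_idem ruler_def)
  finally have "reach M (n + 2 + k * (2 * n + 3))
    (17, [(F, p), (S, int n - 1), (S, 0), (S, xc), (S, xd),
      (R, 1 - int n), (N, 1 - int n), (Q, xq), output_tape ys])
    (18, [(F, p + int (k * n)), (S, int k), (S, 0), (S, xc), (S, xd), (R, - int k),
      (N, - int k), (Q, xq)] @ [output_tape (ys @ bit_rows (\<lambda>i j. j mod k = i) k)])"
    by simp
  then show ?thesis by blast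
qed

lemma outputs_withinI:
  assumes "reach M t (initial_config M w) (18, ts @ [output_tape y])"
  shows "outputs_within M w y t"
  using assms unfolding reach_def outputs_within_def by (force simp: machine_def)

definition small_bit :: "nat \<Rightarrow> nat \<Rightarrow> bool" where
  "small_bit i j \<longleftrightarrow> (if i \<le> k \<and> j \<le> k \<and> i \<noteq> j then col else mat ! (i * n + j))"

definition large_bit :: "nat \<Rightarrow> nat \<Rightarrow> bool" where
  "large_bit i j \<longleftrightarrow> (if i mod k = j mod k \<and> i \<noteq> j then \<not> col else mat ! (i * n + j))"

text \<open>The phases add up to at most 9*n^2 + 22*n + 18, and 30 exceeds each of these
  coefficients.\<close>

definition run_time :: nat where
  "run_time = 30 * (n * n + n + 1)"

lemma machine_correct:
  "(overflow \<and> outputs_within M input_word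
      (enc_nat n @ bit_rows small_bit n @ enc_nat k @ [False]) run_time) \<or>
   (cost ed (n div k) \<le> k \<and> (k = 0 \<longrightarrow> n = 0) \<and> outputs_within M input_word
      (enc_nat n @ bit_rows large_bit n @ enc_nat k @ True # bit_rows (\<lambda>i j. j mod k = i) k)
      run_time)"
proof -
  let ?u = "output_tape (enc_nat n)"
  have u: "?u = (word_on_tape (enc_nat n), int (Suc n))"
    by (simp add: enc_nat_def)
  obtain c R N v y where c: "reach M (n * (3 * k + 5) + 1) (scan_config ?u 0) c"
    "rewind_config ?u v y R N c" "y \<le> n" and R: "\<forall>y. R y = 2 \<longleftrightarrow> y = 0" and
    v: "overflow \<and> v = 1 \<or> v = 2 \<and> cost ed (n div k) \<le> k \<and> (k = 0 \<longrightarrow> n = 0) \<and>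
        R = pos_multiples k n \<and> N = neg_multiples k n"
    using reach_scan_end[of ?u] by blast
  obtain xc xd Q xq where Q: "Q xq = v" and rew: "reach M (n * n + 4 * n + 5) c
    (14, [(F, int (n + 1)), (S, 0), (S, 0), (S, xc), (S, xd), (R, 0), (N, 0), (Q, xq), ?u])"
    using reach_rewind[OF c(2,3)] by blast
  define entry where "entry = (if v = 1 then small_bit else large_bit)"
  \<comment> \<open>In mode \<open>2\<close> the scan has reached the end of the ruler, so the marks
    cover every difference of two vertices.\<close>
  have mult: "(R y \<noteq> 0 \<or> N y \<noteq> 0) \<longleftrightarrow> int k dvd y" if "v = 2" "\<bar>y\<bar> < int n" for y
    using v that by (auto simp: pos_multiples_def neg_multiples_def)
  have "reach M (n * n + 2 * n + 3 * k + 7) (initial_config M input_word) (scan_config ?u 0)"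
    using reach_setup unfolding scan_config_def u by (simp add: cost_0 counter_def blank_eq_ruler)
  also note c(1)
  also note rew
  also have "reach M (n * (2 * n + 3))
    (14, [(F, int (n + 1)), (S, 0), (S, 0), (S, xc), (S, xd), (R, 0), (N, 0), (Q, xq), ?u])
    (14, [(F, int (n + 1) + int (n * n)), (S, int n), (S, 0), (S, xc), (S, xd), (R, - int n),
      (N, - int n), (Q, xq), output_tape (enc_nat n @ bit_rows entry n)])"
  proof (rule reach_rows)
    fix i j assume ij: "i < n" "j < n"
    have "i * n + j < Suc i * n" using ij by simp
    also have "\<dots> \<le> n * n" using ij by (intro mult_right_mono) auto
    finally have F: "F (int (n + 1) + int (i * n + j)) = (if mat ! (i * n + j) then 2 else 1)"
      using F_mat by (metis of_nat_add)
    have S: "2 \<le> S (int i) \<longleftrightarrow> i \<le> k" if "i < n" for i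
      using that by (simp add: ruler_def)
    have dvd: "int k dvd int j - int i \<longleftrightarrow> i mod k = j mod k"
    proof -
      have "int k dvd int j - int i \<longleftrightarrow> int j mod int k = int i mod int k"
        by (simp add: mod_eq_dvd_iff)
      also have "\<dots> \<longleftrightarrow> j mod k = i mod k"
        by (simp flip: zmod_int)
      finally show ?thesis by auto
    qed
    have R2: "R (int j - int i) = 2 \<longleftrightarrow> i = j"
      using R by auto
    show "cell_symbol col v (F (int (n + 1) + int (i * n + j))) (S (int i)) (S (int j))
        (R (int j - int i)) (N (int j - int i)) = (if entry i j then 2 else 1)"
    proof (cases "v = 1")
      case True
      then show ?thesis
        using S ij R2 unfolding F by (simp add: cell_symbol_def entry_def small_bit_def)
    next
      case False
      then have "v = 2" using v by blast
      have "R (int j - int i) = 1 \<or> N (int j - int i) = 1 \<longleftrightarrow> i \<noteq> j \<and> i mod k = j mod k"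
        using v \<open>v = 2\<close> mult[of "int j - int i"] ij dvd
        by (auto simp: pos_multiples_def neg_multiples_def)
      then show ?thesis
        using \<open>v = 2\<close> unfolding F by (auto simp: cell_symbol_def entry_def large_bit_def)
    qed
  qed (use v Q in auto)
  also have "int (n + 1) + int (n * n) = int (n + 1 + n * n)" by simp
  also note reach_param[of v Q xq xc xd R N "enc_nat n @ bit_rows entry n"]
  finally have run: "reach M (n * n + 2 * n + 3 * k + 7 + (n * (3 * k + 5) + 1) +
      (n * n + 4 * n + 5) + n * (2 * n + 3) + (k + 3)) (initial_config M input_word)
    (if v = 1
     then (18, [(F, int (n + 1 + n * n + k + 1)), (S, int n), (S, 0), (S, xc), (S, xd), (R, - int n),
      (N, - int n), (Q, xq), output_tape ((enc_nat n @ bit_rows entry n) @ enc_nat k @ [False])])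
     else (17, [(F, int (n + 1 + n * n + k + 1)), (S, int n - 1), (S, 0), (S, xc), (S, xd),
      (R, 1 - int n), (N, 1 - int n), (Q(xq := 3), xq),
      output_tape ((enc_nat n @ bit_rows entry n) @ enc_nat k @ [True])]))"
    using Q v by auto
  let ?t = "n * n + 2 * n + 3 * k + 7 + (n * (3 * k + 5) + 1) + (n * n + 4 * n + 5) +
    n * (2 * n + 3) + (k + 3)"
  have le: "?t + (n + 2 + k * (2 * n + 3)) \<le> run_time"
  proof -
    have "n * k \<le> n * n" "n \<le> n * n"
      using k_le by simp_all
    then have "?t + (n + 2 + k * (2 * n + 3)) \<le> 9 * (n * n) + 22 * n + 18"
      using k_le unfolding add_mult_distrib2 mult.commute[of k] mult.left_commute[of _ 2]
        mult.left_commute[of _ 3] by linarith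
    then show ?thesis
      unfolding run_time_def by simp
  qed
  show ?thesis
  proof (cases "v = 1")
    case True
    then have eq: "entry = small_bit" by (simp add: entry_def)
    have "reach M run_time (initial_config M input_word)
      (18, [(F, int (n + 1 + n * n + k + 1)), (S, int n), (S, 0), (S, xc), (S, xd), (R, - int n),
       (N, - int n), (Q, xq)] @ [output_tape ((enc_nat n @ bit_rows entry n) @ enc_nat k @ [False])])"
      unfolding append.simps
      by (rule reach_mono[OF run[unfolded if_P[OF True]]])
        (use le in linarith)
    from outputs_withinI[OF this] have "outputs_within M input_word
        (enc_nat n @ bit_rows small_bit n @ enc_nat k @ [False]) run_time"
      by (simp add: eq)
    then show ?thesis
      using v True by simp
  next
    case False
    then have "v = 2" using v by blast
    have "\<exists>ts. reach M (n + 2 + k * (2 * n + 3))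
      (17, [(F, int (n + 1 + n * n + k + 1)), (S, int n - 1), (S, 0), (S, xc), (S, xd),
        (R, 1 - int n), (N, 1 - int n), (Q(xq := 3), xq),
        output_tape ((enc_nat n @ bit_rows entry n) @ enc_nat k @ [True])])
      (18, ts @ [output_tape (((enc_nat n @ bit_rows entry n) @ enc_nat k @ [True]) @
        bit_rows (\<lambda>i j. j mod k = i) k)])"
      using v \<open>v = 2\<close> mult by (intro reach_parts) auto
    then obtain ts where ts: "reach M (n + 2 + k * (2 * n + 3))
      (17, [(F, int (n + 1 + n * n + k + 1)), (S, int n - 1), (S, 0), (S, xc), (S, xd),
        (R, 1 - int n), (N, 1 - int n), (Q(xq := 3), xq),
        output_tape ((enc_nat n @ bit_rows entry n) @ enc_nat k @ [True])])
      (18, ts @ [output_tape (((enc_nat n @ bit_rows entry n) @ enc_nat k @ [True]) @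
        bit_rows (\<lambda>i j. j mod k = i) k)])" by blast
    have "reach M run_time (initial_config M input_word)
      (18, ts @ [output_tape (((enc_nat n @ bit_rows entry n) @ enc_nat k @ [True]) @
        bit_rows (\<lambda>i j. j mod k = i) k)])"
      by (rule reach_mono[OF reach_trans[OF run[unfolded if_not_P[OF False]] ts]])
        (use le in linarith)
    then have "outputs_within M input_word (((enc_nat n @ bit_rows entry n) @ enc_nat k @ [True]) @
        bit_rows (\<lambda>i j. j mod k = i) k) run_time"
      by (rule outputs_withinI)
    then show ?thesis
      using v \<open>v = 2\<close> by (simp add: entry_def)
  qed
qed

end


section \<open>Modified graphs\<close>

text \<open>One operation covers all four modifications: \<open>r\<close> selects the pairs,
  \<open>b\<close> says whether they become edges.\<close>

definition modify :: "(nat \<Rightarrow> nat \<Rightarrow> bool) \<Rightarrow> bool \<Rightarrow> nat graph \<Rightarrow> nat graph" where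
  "modify r b G = \<lparr> verts = verts G, edges = {{i, j} |i j. i \<in> verts G \<and> j \<in> verts G \<and> i \<noteq> j \<and>
     (if r i j then b else {i, j} \<in> edges G)} \<rparr>"

definition related_pairs :: "(nat \<Rightarrow> nat \<Rightarrow> bool) \<Rightarrow> nat set \<Rightarrow> nat set set" where
  "related_pairs r V = {{i, j} |i j. i \<in> V \<and> j \<in> V \<and> i \<noteq> j \<and> r i j}"

lemma verts_modify: "verts (modify r b G) = verts G"
  by (simp add: modify_def)

lemma simple_graph_modify: "simple_graph G \<Longrightarrow> simple_graph (modify r b G)"
  unfolding simple_graph_def modify_def by auto

lemma simple_graph_no_loop: "simple_graph G \<Longrightarrow> {v} \<notin> edges G"
  unfolding simple_graph_def by (metis doubleton_eq_iff insert_absorb2)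

text \<open>An edge may have been put into the set with its ends in either order, so
  \<open>r\<close> has to be symmetric.\<close>

lemma modify_edge_iff:
  assumes "simple_graph G" "symp r" "i \<in> verts G" "j \<in> verts G"
  shows "{i, j} \<in> edges (modify r b G) \<longleftrightarrow> (if r i j \<and> i \<noteq> j then b else {i, j} \<in> edges G)"
proof (cases "i = j")
  case True
  then show ?thesis
    using simple_graph_no_loop[OF assms(1)] simple_graph_no_loop[OF simple_graph_modify[OF assms(1)]]
    by simp
next
  case False
  have "r i j \<longleftrightarrow> r j i"
    using assms(2) by (auto dest: sympD)
  then have "{i, j} \<in> edges (modify r b G) \<Longrightarrow> if r i j then b else {i, j} \<in> edges G"
    unfolding modify_def by (auto simp: doubleton_eq_iff insert_commute split: if_splits)
  moreover have "if r i j then b else {i, j} \<in> edges G \<Longrightarrow> {i, j} \<in> edges (modify r b G)"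
    using False assms(3,4) unfolding modify_def graph.simps
    by (intro CollectI exI[of _ i] exI[of _ j]) simp
  ultimately show ?thesis
    using False by auto
qed

lemma edge_diff_modify:
  assumes "simple_graph G"
  shows "edge_diff G (modify r b G) \<subseteq> related_pairs r (verts G)"
proof
  fix e assume e: "e \<in> edge_diff G (modify r b G)"
  show "e \<in> related_pairs r (verts G)"
  proof (cases "e \<in> edges G")
    case True
    then obtain i j where ij: "i \<in> verts G" "j \<in> verts G" "i \<noteq> j" "e = {i, j}"
      using assms unfolding simple_graph_def by blast
    moreover have "r i j"
    proof (rule ccontr)
      assume "\<not> r i j"
      then have "e \<in> edges (modify r b G)"
        using True ij unfolding modify_def graph.simps
        by (intro CollectI exI[of _ i] exI[of _ j]) simp
      then show False
        using e True by (simp add: edge_diff_def)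
    qed
    ultimately show ?thesis
      unfolding related_pairs_def by blast
  next
    case False
    then obtain i j where ij: "i \<in> verts G" "j \<in> verts G" "i \<noteq> j" "e = {i, j}"
      "if r i j then b else {i, j} \<in> edges G"
      using e unfolding edge_diff_def modify_def by auto
    with False show ?thesis
      unfolding related_pairs_def by (auto split: if_splits)
  qed
qed

section \<open>Degree and edge distance to the modified graph\<close>

lemma finite_related_pairs: "finite V \<Longrightarrow> finite (related_pairs r V)"
  by (rule finite_subset[of _ "Pow V"]) (auto simp: related_pairs_def)

lemma dist_Delta_modify:
  assumes "simple_graph G" "symp r"
    and "\<And>v. v \<in> verts G \<Longrightarrow> card {j \<in> verts G. j \<noteq> v \<and> r v j} \<le> d"
  shows "dist_Delta G (modify r b G) \<le> of_nat d"
proof -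
  let ?D = "\<lparr>verts = verts G, edges = edge_diff G (modify r b G)\<rparr>"
  have fin: "finite (verts G)"
    using assms(1) by (simp add: simple_graph_def)
  have "degree_in ?D v \<le> d" if v: "v \<in> verts G" for v
  proof -
    have "{e \<in> edge_diff G (modify r b G). v \<in> e} \<subseteq> (\<lambda>j. {v, j}) ` {j \<in> verts G. j \<noteq> v \<and> r v j}"
    proof
      fix e assume e: "e \<in> {e \<in> edge_diff G (modify r b G). v \<in> e}"
      then have "e \<in> related_pairs r (verts G)"
        using edge_diff_modify[OF assms(1)] by blast
      then obtain i j where "i \<in> verts G" "j \<in> verts G" "i \<noteq> j" "r i j" "e = {i, j}"
        unfolding related_pairs_def by blast
      then have "\<exists>j. e = {v, j} \<and> j \<in> verts G \<and> j \<noteq> v \<and> r v j"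
        using e assms(2) by (auto simp: insert_commute dest: sympD)
      then show "e \<in> (\<lambda>j. {v, j}) ` {j \<in> verts G. j \<noteq> v \<and> r v j}"
        by blast
    qed
    then have "degree_in ?D v \<le> card {j \<in> verts G. j \<noteq> v \<and> r v j}"
      unfolding degree_in_def graph.simps using fin
      by (intro surj_card_le) auto
    also have "\<dots> \<le> d" by (rule assms(3)[OF v])
    finally show ?thesis .
  qed
  then have "max_degree ?D \<le> d"
    using fin by (simp add: max_degree_def)
  then show ?thesis
    by (simp add: dist_Delta_def verts_modify)
qed

text \<open>Ordered related pairs split into increasing and decreasing ones, exchanged by the swap.
  The factor 2 matters: for the residue classes, \<open>c <= n * q\<close> and
  \<open>q ^ 3 <= 2 * n\<close> alone would give only \<open>c ^ 3 <= 2 * n ^ 4\<close>.\<close>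

lemma handshake:
  assumes "finite V" "symp r"
  shows "2 * card (related_pairs r V) \<le> (\<Sum>v\<in>V. card {j \<in> V. j \<noteq> v \<and> r v j})"
proof -
  define P where "P = Sigma V (\<lambda>v. {j \<in> V. j \<noteq> v \<and> r v j})"
  define A where "A = {(i, j) \<in> P. i < j}"
  define B where "B = {(i, j) \<in> P. j < i}"
  have fin: "finite P"
    using assms(1) by (simp add: P_def)
  have P: "P = A \<union> B" "A \<inter> B = {}"
    by (auto simp: P_def A_def B_def)
  then have finAB: "finite A" "finite B"
    using fin by auto
  have "related_pairs r V \<subseteq> (\<lambda>(i, j). {i, j}) ` A"
  proof
    fix e assume "e \<in> related_pairs r V"
    then obtain i j where ij: "i \<in> V" "j \<in> V" "i \<noteq> j" "r i j" "e = {i, j}"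
      by (auto simp: related_pairs_def)
    then have "(i, j) \<in> A \<or> (j, i) \<in> A"
      using assms(2) by (auto simp: A_def P_def dest: sympD)
    then show "e \<in> (\<lambda>(i, j). {i, j}) ` A"
      using ij(5) by (auto simp: insert_commute intro: rev_image_eqI)
  qed
  then have "card (related_pairs r V) \<le> card A"
    using finAB(1) surj_card_le by blast
  moreover have "B = prod.swap ` A"
    using assms(2) by (force simp: A_def B_def P_def dest: sympD)
  then have "card B = card A"
    by (simp add: card_image)
  moreover have "card P = card A + card B"
    using P finAB by (simp add: card_Un_disjoint)
  moreover have "card P = (\<Sum>v\<in>V. card {j \<in> V. j \<noteq> v \<and> r v j})"
    using assms(1) by (simp add: P_def)
  ultimately show ?thesis by linarith
qed

lemma dist_E_modify:
  assumes "simple_graph G" "symp r"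
  obtains c where "dist_E G (modify r b G) = of_nat c"
    "2 * c \<le> (\<Sum>v\<in>verts G. card {j \<in> verts G. j \<noteq> v \<and> r v j})"
proof
  have fin: "finite (verts G)"
    using assms(1) by (simp add: simple_graph_def)
  show "dist_E G (modify r b G) = of_nat (card (edge_diff G (modify r b G)))"
    by (simp add: dist_E_def verts_modify)
  have "card (edge_diff G (modify r b G)) \<le> card (related_pairs r (verts G))"
    by (intro card_mono finite_related_pairs fin edge_diff_modify assms(1))
  then show "2 * card (edge_diff G (modify r b G)) \<le>
      (\<Sum>v\<in>verts G. card {j \<in> verts G. j \<noteq> v \<and> r v j})"
    using handshake[OF fin assms(2)] by linarith
qed


section \<open>The two cases\<close>

definition distance :: "bool \<Rightarrow> nat graph \<Rightarrow> nat graph \<Rightarrow> ennreal" where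
  "distance ed = (if ed then dist_E else dist_Delta)"

definition bound :: "bool \<Rightarrow> nat \<Rightarrow> ennreal" where
  "bound ed n = ennreal (real n powr (if ed then 4 / 3 else 1 / 2))"

lemma nat_le_powr:
  assumes "c ^ b \<le> n ^ a" "0 < a" "0 < b"
  shows "real c \<le> real n powr (real a / real b)"
proof (cases "c = 0")
  case False
  then have n: "0 < n"
    using assms by (metis bot_nat_0.not_eq_extremum le_zero_eq power_eq_0_iff zero_power)
  have "real c = (real c powr real b) powr (1 / real b)"
    using False assms(3) by (simp add: powr_powr)
  also have "real c powr real b = real (c ^ b)"
    using False by (simp add: powr_realpow)
  also have "real (c ^ b) powr (1 / real b) \<le> real (n ^ a) powr (1 / real b)"
    using assms(1) by (intro powr_mono2) (simp_all only: of_nat_le_iff, simp_all)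
  also have "real (n ^ a) = real n powr real a"
    using n by (simp add: powr_realpow)
  also have "(real n powr real a) powr (1 / real b) = real n powr (real a / real b)"
    by (simp add: powr_powr)
  finally show ?thesis .
qed simp

text \<open>The last two assumptions are the bounds n^(1/2) and n^(4/3) with the roots cleared, so
  the rest is arithmetic of natural numbers.\<close>

lemma distance_modify:
  assumes "simple_graph G" "symp r" "card (verts G) = n"
    and "\<And>v. v \<in> verts G \<Longrightarrow> card {j \<in> verts G. j \<noteq> v \<and> r v j} \<le> d"
    and "\<not> ed \<Longrightarrow> d ^ 2 \<le> n"
    and "\<And>c. ed \<Longrightarrow> 2 * c \<le> (\<Sum>v\<in>verts G. card {j \<in> verts G. j \<noteq> v \<and> r v j}) \<Longrightarrow> c ^ 3 \<le> n ^ 4"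
  shows "distance ed G (modify r b G) \<le> bound ed n"
proof (cases ed)
  case True
  obtain c where c: "dist_E G (modify r b G) = of_nat c"
    "2 * c \<le> (\<Sum>v\<in>verts G. card {j \<in> verts G. j \<noteq> v \<and> r v j})"
    by (rule dist_E_modify[OF assms(1,2)])
  then have "real c \<le> real n powr (4 / 3)"
    using nat_le_powr[of c 3 n 4] assms(6)[OF True] by simp
  then show ?thesis
    using True c(1) by (simp add: distance_def bound_def ennreal_of_nat_eq_real_of_nat ennreal_leI)
next
  case False
  have "dist_Delta G (modify r b G) \<le> of_nat d"
    by (rule dist_Delta_modify[OF assms(1,2,4)])
  also have "real d \<le> real n powr (1 / 2)"
    using nat_le_powr[of d 2 n 1] assms(5)[OF False] by simp
  then have "of_nat d \<le> ennreal (real n powr (1 / 2))"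
    by (simp add: ennreal_of_nat_eq_real_of_nat ennreal_leI)
  finally show ?thesis
    using False by (simp add: distance_def bound_def)
qed

lemma cost_False: "cost False q = q"
  by (simp add: cost_def)

lemma cost_True: "2 * cost True q = q * (q + 1)"
  by (induction q) (simp_all add: cost_0 cost_Suc)

definition homogeneous :: "bool \<Rightarrow> nat graph \<Rightarrow> nat set \<Rightarrow> bool" where
  "homogeneous col = (if col then independent_set else clique)"

definition problem :: "bool \<Rightarrow> (nat graph \<times> nat, nat set set) search_problem" where
  "problem col = (if col then Coloring else Clique_Cover)"

lemma problem_simps:
  "inputs (problem col) = graph_inputs"
  "input_size (problem col) (G, k) = card (verts G)"
  "is_solution (problem col) (G, k) P \<longleftrightarrow>
     partition_on (verts G) P \<and> card P = k \<and> (\<forall>A\<in>P. homogeneous col G A)"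
  by (simp_all add: problem_def Coloring_def Clique_Cover_def homogeneous_def)

definition both_le :: "nat \<Rightarrow> nat \<Rightarrow> nat \<Rightarrow> bool" where
  "both_le k i j \<longleftrightarrow> i \<le> k \<and> j \<le> k"

definition same_residue :: "nat \<Rightarrow> nat \<Rightarrow> nat \<Rightarrow> bool" where
  "same_residue k i j \<longleftrightarrow> i mod k = j mod k"

lemma symp_both_le: "symp (both_le k)"
  by (simp add: symp_def both_le_def)

lemma symp_same_residue: "symp (same_residue k)"
  by (simp add: symp_def same_residue_def)

text \<open>For edges, \<open>k < q * (q + 1) / 2 <= q ^ 2\<close> gives
  \<open>k ^ 3 <= (q * k) ^ 2 <= n ^ 2\<close>, and at most \<open>k * (k + 1) / 2 <= k ^ 2\<close>
  edges change. Any \<open>q\<close> with \<open>q * k <= n\<close> will do, so the scan may stop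
  early.\<close>

lemma distance_small:
  assumes "simple_graph G" "verts G = {..<n}" "q * k \<le> n" "k < cost ed q"
  shows "distance ed G (modify (both_le k) b G) \<le> bound ed n"
proof (rule distance_modify[where d = k, OF assms(1) symp_both_le])
  have card: "card {j \<in> {..<n}. j \<noteq> v \<and> both_le k v j} \<le> (if v \<le> k then k else 0)" for v
  proof (cases "v \<le> k")
    case True
    have "card {j \<in> {..<n}. j \<noteq> v \<and> both_le k v j} \<le> card ({..k} - {v})"
      by (intro card_mono) (auto simp: both_le_def)
    then show ?thesis using True by simp
  next
    case False
    then show ?thesis by (simp add: both_le_def)
  qed
  show "card {j \<in> verts G. j \<noteq> v \<and> both_le k v j} \<le> k" for v
    unfolding assms(2) by (rule order_trans[OF card]) simp
  show "k ^ 2 \<le> n" if "\<not> ed"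
  proof -
    have "k * k \<le> q * k"
      using assms(4) that by (intro mult_right_mono) (simp_all add: cost_False)
    from order_trans[OF this assms(3)] show ?thesis
      by (simp add: power2_eq_square)
  qed
  fix c
  assume ed: ed and c: "2 * c \<le> (\<Sum>v\<in>verts G. card {j \<in> verts G. j \<noteq> v \<and> both_le k v j})"
  note c
  also have "\<dots> \<le> (\<Sum>v<n. if v \<le> k then k else 0)"
    unfolding assms(2) by (intro sum_mono card)
  also have "\<dots> = (\<Sum>v | v < n \<and> v \<le> k. k)"
    by (simp add: sum.If_cases lessThan_def Collect_conj_eq)
  also have "\<dots> \<le> (\<Sum>v\<le>k. k)"
    by (intro sum_mono2) auto
  finally have "2 * c \<le> (k + 1) * k" by simp
  also have "\<dots> \<le> 2 * k ^ 2"
    by (cases "k = 0") (simp_all add: power2_eq_square)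
  finally have c: "c \<le> k ^ 2" by simp
  have "2 * cost True q \<le> 2 * q ^ 2"
    unfolding cost_True by (cases "q = 0") (simp_all add: power2_eq_square)
  then have "k \<le> q ^ 2"
    using assms(4) ed by simp
  then have "k ^ 2 * k \<le> k ^ 2 * q ^ 2"
    by (rule mult_left_mono) simp
  also have "\<dots> = (q * k) ^ 2"
    by (simp add: power_mult_distrib)
  also have "\<dots> \<le> n ^ 2"
    using assms(3) by (rule power_mono) simp
  finally have "k ^ 3 \<le> n ^ 2"
    by (simp add: power2_eq_square power3_eq_cube)
  then have "(k ^ 3) ^ 2 \<le> (n ^ 2) ^ 2"
    by (rule power_mono) simp
  moreover have "c ^ 3 \<le> (k ^ 2) ^ 3"
    using c by (rule power_mono) simp
  ultimately show "c ^ 3 \<le> n ^ 4"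
    by (simp flip: power_mult)
qed (simp add: assms(2))

text \<open>Within a class \<open>j\<close> is determined by its quotient, which lies in
  \<open>{..n div k}\<close> and differs from the quotient of \<open>v\<close>.\<close>

lemma card_same_residue_le:
  assumes "0 < k" "v < n"
  shows "card {j \<in> {..<n}. j \<noteq> v \<and> same_residue k v j} \<le> n div k"
proof -
  let ?A = "{j \<in> {..<n}. j \<noteq> v \<and> same_residue k v j}"
  have "inj_on (\<lambda>j. j div k) ?A"
  proof (rule inj_onI)
    fix x y assume "x \<in> ?A" "y \<in> ?A" "x div k = y div k"
    then show "x = y"
      by (simp add: same_residue_def) (metis div_mult_mod_eq)
  qed
  moreover have "(\<lambda>j. j div k) ` ?A \<subseteq> {..n div k} - {v div k}"
  proof
    fix x assume "x \<in> (\<lambda>j. j div k) ` ?A"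
    then obtain j where j: "j < n" "j \<noteq> v" "v mod k = j mod k" "x = j div k"
      by (auto simp: same_residue_def)
    then have "j div k \<noteq> v div k"
      by (metis div_mult_mod_eq)
    then show "x \<in> {..n div k} - {v div k}"
      using j by (simp add: div_le_mono)
  qed
  ultimately have "card ?A \<le> card ({..n div k} - {v div k})"
    by (intro card_inj_on_le) auto
  also have "\<dots> = n div k"
    using assms by (simp add: div_le_mono)
  finally show ?thesis .
qed

text \<open>For edges, \<open>q ^ 2 <= 2 * k\<close> gives \<open>q ^ 3 <= 2 * n\<close>; with
  \<open>2 * c <= n * q\<close> this yields \<open>8 * c ^ 3 <= 2 * n ^ 4\<close>.\<close>

lemma distance_large:
  assumes "simple_graph G" "verts G = {..<n}" "cost ed (n div k) \<le> k" "k = 0 \<longrightarrow> n = 0"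
  shows "distance ed G (modify (same_residue k) b G) \<le> bound ed n"
proof (rule distance_modify[where d = "n div k", OF assms(1) symp_same_residue])
  define q where "q = n div k"
  have qk: "q * k \<le> n"
    by (simp add: q_def)
  have card: "card {j \<in> {..<n}. j \<noteq> v \<and> same_residue k v j} \<le> q" if "v < n" for v
    unfolding q_def using that assms(4) by (intro card_same_residue_le) auto
  then show "card {j \<in> verts G. j \<noteq> v \<and> same_residue k v j} \<le> n div k" if "v \<in> verts G" for v
    using that unfolding assms(2) q_def by simp
  show "(n div k) ^ 2 \<le> n" if "\<not> ed"
  proof -
    have "q * q \<le> q * k"
      using assms(3) that by (intro mult_left_mono) (simp_all add: cost_False q_def)
    from order_trans[OF this qk] show ?thesis
      by (simp add: power2_eq_square q_def)
  qed
  fix c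
  assume ed: ed and c: "2 * c \<le> (\<Sum>v\<in>verts G. card {j \<in> verts G. j \<noteq> v \<and> same_residue k v j})"
  note c
  also have "\<dots> \<le> (\<Sum>v<n. q)"
    unfolding assms(2) by (intro sum_mono card) simp
  finally have c: "2 * c \<le> n * q" by simp
  have "q * (q + 1) \<le> 2 * k"
    using assms(3) ed unfolding cost_True[symmetric] by (simp add: q_def)
  then have "q * q \<le> 2 * k" by simp
  then have "q * q * q \<le> 2 * k * q"
    by (rule mult_right_mono) simp
  also have "\<dots> \<le> 2 * n"
    using qk by (simp add: mult.commute)
  finally have "q ^ 3 \<le> 2 * n"
    by (simp add: power3_eq_cube)
  then have "n ^ 3 * q ^ 3 \<le> n ^ 3 * (2 * n)"
    by (rule mult_left_mono) simp
  moreover have "(2 * c) ^ 3 \<le> (n * q) ^ 3"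
    using c by (rule power_mono) simp
  ultimately have "(2 * c) ^ 3 \<le> n ^ 3 * (2 * n)"
    unfolding power_mult_distrib[of n] by linarith
  then have "8 * c ^ 3 \<le> 2 * n ^ 4"
    by (simp add: power3_eq_cube power4_eq_xxxx mult_ac)
  then show "c ^ 3 \<le> n ^ 4" by simp
qed (simp add: assms(2))

text \<open>Pigeonhole: two of the \<open>k + 1\<close> vertices \<open>0, ..., k\<close> share a
  part, but every pair of them is forbidden there. The vertex \<open>k\<close> exists because
  \<open>k < n\<close>.\<close>

lemma no_solution_small:
  assumes "simple_graph G" "verts G = {..<n}" "k < n"
  shows "\<not> is_solution (problem col) (modify (both_le k) col G, k) P"
proof
  let ?H = "modify (both_le k) col G"
  assume "is_solution (problem col) (?H, k) P"
  then have P: "partition_on {..<n} P" "card P = k" "\<And>A. A \<in> P \<Longrightarrow> homogeneous col ?H A"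
    by (simp_all add: problem_simps verts_modify assms(2))
  have fin: "finite P"
    by (rule finite_elements[OF _ P(1)]) simp
  have "\<forall>v\<in>{..k}. \<exists>A\<in>P. v \<in> A"
    using P(1) assms(3) unfolding partition_on_def by auto
  then obtain f where f: "\<And>v. v \<le> k \<Longrightarrow> f v \<in> P \<and> v \<in> f v"
    by (metis atMost_iff)
  have "card (f ` {..k}) \<le> k"
    using card_mono[OF fin, of "f ` {..k}"] f P(2) by auto
  then have "\<not> inj_on f {..k}"
    by (intro notI) (simp add: card_image)
  then obtain u v where uv: "u \<le> k" "v \<le> k" "u \<noteq> v" "f u = f v"
    by (auto simp: inj_on_def)
  then have "u \<in> f u" "v \<in> f u" "homogeneous col ?H (f u)"
    using f[of u] f[of v] P(3) by auto
  moreover have "{u, v} \<in> edges ?H \<longleftrightarrow> col"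
    using modify_edge_iff[OF assms(1) symp_both_le, of u v k col] uv assms(2,3)
    by (simp add: both_le_def)
  ultimately show False
    using uv(3) by (auto simp: homogeneous_def independent_set_def clique_def split: if_splits)
qed

definition residue_classes :: "nat \<Rightarrow> nat \<Rightarrow> nat set list" where
  "residue_classes n k = map (\<lambda>i. {j. j < n \<and> j mod k = i}) [0..<k]"

lemma distinct_residue_classes:
  assumes "k \<le> n"
  shows "distinct (residue_classes n k)"
proof -
  have "inj_on (\<lambda>i. {j. j < n \<and> j mod k = i}) {..<k}"
  proof (rule inj_onI)
    fix x y
    assume x: "x \<in> {..<k}" and eq: "{j. j < n \<and> j mod k = x} = {j. j < n \<and> j mod k = y}"
    have "x \<in> {j. j < n \<and> j mod k = x}"
      using x assms by simp
    then have "x \<in> {j. j < n \<and> j mod k = y}"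
      by (rule subst[OF eq])
    then show "x = y"
      using x by simp
  qed
  then show ?thesis
    unfolding residue_classes_def distinct_map by (simp add: atLeast0LessThan)
qed

text \<open>As \<open>k <= n\<close>, class \<open>i\<close> contains \<open>i\<close> itself, so
  there are exactly \<open>k\<close> nonempty parts.\<close>

lemma solution_large:
  assumes "simple_graph G" "verts G = {..<n}" "k \<le> n" "k = 0 \<longrightarrow> n = 0"
  shows "is_solution (problem col) (modify (same_residue k) (\<not> col) G, k)
    (set (residue_classes n k))"
proof -
  let ?H = "modify (same_residue k) (\<not> col) G"
  have "partition_on {..<n} (set (residue_classes n k))"
  proof (rule partition_onI)
    show "\<Union> (set (residue_classes n k)) = {..<n}"
      using assms(4) by (force simp: residue_classes_def)
    show "disjnt p p'" if "p \<in> set (residue_classes n k)" "p' \<in> set (residue_classes n k)" "p \<noteq> p'"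
      for p p'
      using that by (auto simp: residue_classes_def disjnt_def)
    have "{j. j < n \<and> j mod k = i} \<noteq> {}" if "i < k" for i
      using that assms(3) by (auto intro!: exI[of _ i])
    then show "{} \<notin> set (residue_classes n k)"
      unfolding residue_classes_def
      by (metis (no_types, lifting) atLeastLessThan_iff image_iff list.set_map set_upt)
  qed
  moreover have "card (set (residue_classes n k)) = k"
    using distinct_card[OF distinct_residue_classes[OF assms(3)]] by (simp add: residue_classes_def)
  moreover have "homogeneous col ?H A" if "A \<in> set (residue_classes n k)" for A
  proof -
    have A: "A \<subseteq> verts ?H"
      using that by (auto simp: residue_classes_def verts_modify assms(2))
    have "{u, v} \<in> edges ?H \<longleftrightarrow> \<not> col" if "u \<in> A" "v \<in> A" "u \<noteq> v" for u v
      using modify_edge_iff[OF assms(1) symp_same_residue, of u v k "\<not> col"] that A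
        \<open>A \<in> set (residue_classes n k)\<close>
      by (auto simp: assms(2) same_residue_def residue_classes_def)
    moreover have "{u} \<notin> edges ?H" for u
      by (rule simple_graph_no_loop[OF simple_graph_modify[OF assms(1)]])
    ultimately show ?thesis
      using A by (auto simp: homogeneous_def independent_set_def clique_def)
        (metis insert_absorb2)
  qed
  ultimately show ?thesis
    by (simp add: problem_simps verts_modify assms(2))
qed


section \<open>Encodings and the theorem\<close>

lemma nth_concat_rows:
  assumes "i < m" "j < n"
  shows "concat (map (\<lambda>i. map (f i) [0..<n]) [0..<m]) ! (i * n + j) = f i j"
  using assms(1)
proof (induction m)
  case (Suc m)
  have len: "length (concat (map (\<lambda>i. map (f i) [0..<n]) [0..<m])) = m * n"
    by (induction m) simp_all
  show ?case
  proof (cases "i < m")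
    case True
    have "i * n + j < Suc i * n" using assms(2) by simp
    also have "\<dots> \<le> m * n" using True by (intro mult_right_mono) auto
    finally show ?thesis
      using Suc.IH[OF True] by (simp add: nth_append len)
  next
    case False
    then have "i = m" using Suc.prems by simp
    then show ?thesis
      using assms(2) by (simp add: nth_append len)
  qed
qed simp

definition adjacency_bits :: "nat graph \<Rightarrow> nat \<Rightarrow> bool list" where
  "adjacency_bits G n = concat (map (\<lambda>i. map (\<lambda>j. {i, j} \<in> edges G) [0..<n]) [0..<n])"

lemma length_adjacency_bits: "length (adjacency_bits G n) = n * n"
  by (simp add: adjacency_bits_def length_concat o_def sum_list_triv)

lemma nth_adjacency_bits: "i < n \<Longrightarrow> j < n \<Longrightarrow> adjacency_bits G n ! (i * n + j) \<longleftrightarrow> {i, j} \<in> edges G"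
  unfolding adjacency_bits_def using nth_concat_rows[of i n j n "\<lambda>i j. {i, j} \<in> edges G"] by simp

lemma enc_input_eq:
  "card (verts G) = n \<Longrightarrow> enc_input (G, k) = enc_nat n @ adjacency_bits G n @ enc_nat k"
  by (simp add: enc_graph_def adjacency_bits_def Let_def)

lemma outputs_within_mono: "outputs_within M w y s \<Longrightarrow> s \<le> t \<Longrightarrow> outputs_within M w y t"
  unfolding outputs_within_def by (elim exE conjE, intro exI conjI, rule le_trans)

context machine_run
begin

lemma adjacency_bits_eq_bit_rows:
  assumes "\<And>i j. i < n \<Longrightarrow> j < n \<Longrightarrow> {i, j} \<in> edges H \<longleftrightarrow> entry i j"
  shows "adjacency_bits H n = bit_rows entry n"
  unfolding adjacency_bits_def bit_rows_def
  by (intro arg_cong[of _ _ concat] map_cong refl) (use assms in auto)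

lemma bit_rows_residue_classes:
  "bit_rows (\<lambda>i j. j mod k = i) k = concat (map (enc_vertex_set n) (residue_classes n k))"
  unfolding bit_rows_def residue_classes_def map_map
  by (intro arg_cong[of _ _ concat] map_cong refl) (simp add: enc_vertex_set_def)

end

lemma machine_solves:
  assumes "(G, k) \<in> graph_inputs"
  defines "n \<equiv> card (verts G)"
  shows "\<exists>H a y. (H, k) \<in> graph_inputs \<and> verts H = verts G \<and> distance ed G H \<le> bound ed n \<and>
    correct_answer (problem col) (H, k) a \<and> y \<in> enc_output ((H, k), a) \<and>
    outputs_within (machine col ed) (enc_input (G, k)) y (30 * (n * n + n + 1))"
proof -
  have G: "simple_graph G" "verts G = {..<n}" and k: "k \<le> n"
    using assms by (auto simp: graph_inputs_def)
  note bits = nth_adjacency_bits[of _ n _ G]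
  interpret machine_run col ed n k "adjacency_bits G n"
  proof
    show "k \<le> n" by fact
    show "length (adjacency_bits G n) = n * n" by (rule length_adjacency_bits)
    show "\<not> adjacency_bits G n ! (n * n - 1)" if pos: "n > 0"
    proof -
      obtain l where "n = Suc l" using pos by (cases n) auto
      then have "n * n - 1 = (n - 1) * n + (n - 1)" by simp
      then show ?thesis
        using bits[of "n - 1" "n - 1"] pos simple_graph_no_loop[OF G(1)] by simp
    qed
  qed
  have input: "enc_input (G, k) = input_word"
    unfolding input_word_def by (rule enc_input_eq) (simp add: n_def)
  have time: "30 * (n * n + n + 1) = run_time"
    by (simp add: run_time_def)
  have modified: "(modify r b G, k) \<in> graph_inputs" "enc_input (modify r b G, k) =
      enc_nat n @ adjacency_bits (modify r b G) n @ enc_nat k" for r b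
    using assms(1) simple_graph_modify
    by (auto simp: graph_inputs_def verts_modify n_def enc_input_eq simp del: enc_input.simps)
  show ?thesis
    using machine_correct
  proof (elim disjE conjE)
    assume "overflow" and out: "outputs_within (machine col ed) input_word
      (enc_nat n @ bit_rows small_bit n @ enc_nat k @ [False]) run_time"
    then obtain q where q: "q * k \<le> n" "k < cost ed q" and "0 < n"
      unfolding overflow_def by blast
    \<comment> \<open>Vertex \<open>k\<close> has to exist. For \<open>k = n\<close> only
      \<open>q <= 1\<close> would fit, at a price of at most 1, which the budget \<open>n\<close>
      covers.\<close>
    have "k \<noteq> n"
    proof
      assume "k = n"
      then have "q \<le> 1" using q(1) \<open>0 < n\<close> by simp
      then have "cost ed q \<le> 1"
        by (cases q) (simp_all add: cost_0 cost_Suc)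
      then show False using q(2) \<open>k = n\<close> \<open>0 < n\<close> by simp
    qed
    then have "k < n" using k by simp
    let ?H = "modify (both_le k) col G"
    have "adjacency_bits ?H n = bit_rows small_bit n"
      using modify_edge_iff[OF G(1) symp_both_le] G(2) bits
      by (intro adjacency_bits_eq_bit_rows) (auto simp: small_bit_def both_le_def)
    then have "enc_nat n @ bit_rows small_bit n @ enc_nat k @ [False] \<in> enc_output ((?H, k), None)"
      by (simp add: modified(2) del: enc_input.simps)
    moreover have "correct_answer (problem col) (?H, k) None"
      unfolding correct_answer_def using no_solution_small[OF G \<open>k < n\<close>] by simp
    moreover have "distance ed G ?H \<le> bound ed n"
      by (rule distance_small[OF G q])
    ultimately show ?thesis
      unfolding input time using modified(1) verts_modify out by blast
  next
    assume large: "cost ed (n div k) \<le> k" "k = 0 \<longrightarrow> n = 0"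
      and out: "outputs_within (machine col ed) input_word
        (enc_nat n @ bit_rows large_bit n @ enc_nat k @ True # bit_rows (\<lambda>i j. j mod k = i) k)
        run_time"
    let ?H = "modify (same_residue k) (\<not> col) G" and ?P = "set (residue_classes n k)"
    have "adjacency_bits ?H n = bit_rows large_bit n"
      using modify_edge_iff[OF G(1) symp_same_residue] G(2) bits
      by (intro adjacency_bits_eq_bit_rows) (auto simp: large_bit_def same_residue_def)
    moreover have "card (verts ?H) = n"
      by (simp add: verts_modify n_def)
    ultimately have "enc_nat n @ bit_rows large_bit n @ enc_nat k @ True # bit_rows (\<lambda>i j. j mod k = i) k
        \<in> enc_output ((?H, k), Some ?P)"
      using distinct_residue_classes[OF k]
      by (auto simp: modified(2) bit_rows_residue_classes simp del: enc_input.simps)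
    moreover have "correct_answer (problem col) (?H, k) (Some ?P)"
      unfolding correct_answer_def using solution_large[OF G k large(2)] by simp
    moreover have "distance ed G ?H \<le> bound ed n"
      by (rule distance_large[OF G large])
    ultimately show ?thesis
      unfolding input time using modified(1) verts_modify out by blast
  qed
qed

lemma Rel_in_FP:
  "Rel (problem col) (dist_param (distance ed)) (bound ed) \<in> FP enc_input enc_output"
proof -
  let ?p = "[:0, 0, 30:] :: nat poly"
  have "\<exists>out y. is_output (Rel (problem col) (dist_param (distance ed)) (bound ed)) I out \<and>
      y \<in> enc_output out \<and>
      outputs_within (machine col ed) (enc_input I) y (poly ?p (length (enc_input I)))"
    if mem: "I \<in> graph_inputs" for I
  proof -
    obtain G k where I: "I = (G, k)" by (cases I)
    define n where "n = card (verts G)"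
    obtain H a y where H: "(H, k) \<in> graph_inputs" "verts H = verts G"
      "distance ed G H \<le> bound ed n" "correct_answer (problem col) (H, k) a"
      "y \<in> enc_output ((H, k), a)"
      "outputs_within (machine col ed) (enc_input (G, k)) y (30 * (n * n + n + 1))"
      using machine_solves[of G k ed col] mem unfolding I n_def by blast
    \<comment> \<open>The two unary terminators and the unary \<open>n\<close> already have this
      length; its square dominates the run time, hence the polynomial 30*x^2.\<close>
    have "n + 2 \<le> length (enc_input I)"
      unfolding I enc_input_eq[OF n_def[symmetric]] by (simp add: enc_nat_def)
    from mult_le_mono[OF this this] have "30 * (n * n + n + 1) \<le> poly ?p (length (enc_input I))"
      by (simp add: algebra_simps)
    then have "outputs_within (machine col ed) (enc_input I) y (poly ?p (length (enc_input I)))"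
      using H(6) outputs_within_mono unfolding I by blast
    moreover have "is_output (Rel (problem col) (dist_param (distance ed)) (bound ed)) I ((H, k), a)"
      using H by (simp add: Rel_def I problem_simps n_def)
    ultimately show ?thesis
      using H(5) by blast
  qed
  moreover have "instances (Rel (problem col) (dist_param (distance ed)) (bound ed)) = graph_inputs"
    by (simp add: Rel_def problem_simps)
  ultimately show ?thesis
    unfolding FP_def using wf_machine[of col ed]
    by (intro CollectI exI[of _ "machine col ed"] exI[of _ ?p] conjI ballI) simp_all
qed

theorem theorem18:
  shows "\<forall>Pr \<in> {Coloring, Clique_Cover}.
    Rel Pr (dist_param dist_Delta) (\<lambda>n. ennreal (real n powr (1 / 2)))
      \<in> FP enc_input enc_output \<and>
    Rel Pr (dist_param dist_E) (\<lambda>n. ennreal (real n powr (4 / 3)))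
      \<in> FP enc_input enc_output"
proof -
  have bound: "bound False = (\<lambda>n. ennreal (real n powr (1 / 2)))"
    "bound True = (\<lambda>n. ennreal (real n powr (4 / 3)))"
    by (simp_all add: bound_def fun_eq_iff)
  have "Rel (problem col) (dist_param dist_Delta) (\<lambda>n. ennreal (real n powr (1 / 2)))
      \<in> FP enc_input enc_output \<and>
    Rel (problem col) (dist_param dist_E) (\<lambda>n. ennreal (real n powr (4 / 3)))
      \<in> FP enc_input enc_output" for col
    using Rel_in_FP[of col False] Rel_in_FP[of col True] by (simp add: bound distance_def)
  from this[of True] this[of False] show ?thesis
    by (simp add: problem_def)
qed

end
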